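(* Let $X$ be a Banach space whose dual unit ball $B_{X^*}$ is weak*-sequentially compact. If $X$ does not have the fixed point property (FPP), then $J(X) = 2$.
   Context: $X^*$ is the dual space of $X$. $B_{X^*} = \{f \in X^* : \|f\| \leq 1\}$ is its closed unit ball; it is weak*-sequentially compact if every sequence in $B_{X^*}$ has a subsequence converging in the weak* topology to an element of $B_{X^*}$. $S_X = \{x \in X : \|x\| = 1\}$ is the unit sphere of $X$. The James constant of $X$ is $$J(X) = \sup\{ \min( \|x+y\|, \|x-y\| ) : x, y \in S_X \}.$$ A Banach space $X$ has the fixed point property (FPP) if for every nonempty closed bounded convex subset $C \subseteq X$, every nonexpansive map $T : C \to C$ (that is, $\|Tx - Ty\| \leq \|x - y\|$ for all $x, y \in C$) has a fixed point in $C$. *)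

theory Defs
  imports "HOL-Analysis.Analysis"
begin

text \<open>
  The dual of a real normed space is the type of bounded linear functionals with the operator norm.
  For scalar-valued operators the strong operator topology, i.e. the topology of pointwise
  convergence pulled back along \<^const>\<open>blinfun_apply\<close>, is the weak* topology.
\<close>

abbreviation weak_star_topology :: "('a::real_normed_vector \<Rightarrow>\<^sub>L real) topology" where
  "weak_star_topology \<equiv> strong_operator_topology"

definition weak_star_seq_compact :: "('a::real_normed_vector \<Rightarrow>\<^sub>L real) set \<Rightarrow> bool" where
  "weak_star_seq_compact K \<longleftrightarrow>
     (\<forall>f :: nat \<Rightarrow> 'a \<Rightarrow>\<^sub>L real. (\<forall>n. f n \<in> K) \<longrightarrow>
        (\<exists>l\<in>K. \<exists>r :: nat \<Rightarrow> nat. strict_mono r \<and>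
           limitin weak_star_topology (f \<circ> r) l sequentially))"

text \<open>
  The supremum is over a set bounded above by 2. If the space is trivial, the unit sphere is empty
  and the value carries no meaning.
\<close>

definition james_constant :: "'a::real_normed_vector itself \<Rightarrow> real" where
  "james_constant _ =
     Sup {min (norm (x + y)) (norm (x - y)) | x y :: 'a. x \<in> sphere 0 1 \<and> y \<in> sphere 0 1}"

text \<open>
  A map from C to itself is represented by a total function mapping C into C; its values outside C
  are irrelevant.
\<close>

definition nonexpansive_on :: "'a::real_normed_vector set \<Rightarrow> ('a \<Rightarrow> 'a) \<Rightarrow> bool" where
  "nonexpansive_on C T \<longleftrightarrow> (\<forall>x\<in>C. \<forall>y\<in>C. norm (T x - T y) \<le> norm (x - y))"

definition fixed_point_property :: "'a::real_normed_vector itself \<Rightarrow> bool" where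
  "fixed_point_property _ \<longleftrightarrow>
     (\<forall>(C :: 'a set) T. C \<noteq> {} \<and> closed C \<and> bounded C \<and> convex C \<and>
        T \<in> C \<rightarrow> C \<and> nonexpansive_on C T \<longrightarrow> (\<exists>x\<in>C. T x = x))"

end

theory Submission
  imports Defs
begin

text \<open>
  The trivial space has the fixed point property. In any other space the James constant is at most 2,
  so suppose that it is smaller. Then there is \<open>\<rho> < 2\<close> such that
  \<open>x + y\<close> or \<open>x - y\<close> has norm at most \<open>\<rho> r\<close> whenever \<open>x\<close> and \<open>y\<close> lie in the ball of radius \<open>r\<close>.
  The fixed point property follows in two steps.

  The first step is the part of James's theorem (uniformly nonsquare spaces are reflexive) that is
  needed, in a form that mentions no functionals: every downward directed family of nonempty closed
  bounded convex sets has a common point (\<open>convexly_compact_if_nonsquare\<close>). If such a family had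
  none, one could choose from it a bounded sequence for which the convex hulls of the first \<open>p\<close>
  terms and of the remaining ones stay at a fixed distance from each other, for all \<open>p\<close>. Iterated
  limits along an ultrafilter turn the norms of linear combinations of this sequence into a
  functional \<open>N\<close> on lists of coefficients that ignores zeros, and repeated splitting of
  coefficients into halves makes \<open>N\<close> invariant under splitting; from then on, merging adjacent
  coefficients cannot increase \<open>N\<close>. Let \<open>K\<^sub>n\<close> be the value of \<open>N\<close> on the list \<open>1, -2, 2, -2, ...\<close> with
  \<open>n\<close> entries of modulus 2 and last entry of modulus 1. Two interlaced copies of the list have sum of
  value \<open>2 K\<^sub>n\<close> and difference of value at least \<open>2 K\<^sub>n\<^sub>-\<^sub>1\<close>, so nonsquareness makes \<open>K\<^sub>n\<close> grow
  geometrically, whereas the triangle inequality permits only linear growth.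

  In the second step, compactness supplies a minimal invariant set \<open>D\<close> of a nonexpansive map \<open>T\<close> and
  weak limits along an ultrafilter. Let \<open>d\<close> be the diameter of \<open>D\<close> and \<open>x\<^sub>n\<close> approximate fixed points
  with weak limit \<open>z\<^sub>0\<close>. By the Goebel--Karlovitz lemma, points of \<open>D\<close> that are almost fixed have
  distance almost \<open>d\<close> from \<open>z\<^sub>0\<close>. Perturbing \<open>T\<close> towards the midpoints of \<open>x\<^sub>n\<close> and \<open>z\<^sub>0\<close> gives
  almost fixed points \<open>w\<^sub>n\<close> that lie within \<open>d / 2\<close> of each other and nearly so of \<open>x\<^sub>n\<close>. With the
  weak limit \<open>z\<close> of \<open>w\<^sub>n\<close>, the vectors \<open>p = z - z\<^sub>0\<close> and \<open>q = w\<^sub>m - w\<^sub>n\<close> have norm at most about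
  \<open>d / 2\<close>, while \<open>p + q\<close> and \<open>p - q\<close> have norm almost \<open>d\<close> for suitable \<open>n\<close> and \<open>m\<close>
  (\<open>almost_square\<close>). This contradicts nonsquareness unless \<open>d = 0\<close>, in which case the only point of
  \<open>D\<close> is fixed.
\<close>

section \<open>Maximal intersection-closed families and ultrafilters\<close>

text \<open>
  The common source of ultrafilters (\<open>K\<close>: the infinite sets of natural numbers), of maximal directed
  families of closed bounded convex sets, and of minimal invariant sets (\<open>K\<close>: the invariant closed
  bounded convex sets). Maximality is expressed by the last clause: a set \<open>D\<close> all of whose traces on
  members stay in \<open>K\<close> could be added to the family, so the traces are already members.
\<close>

lemma maximal_intersection_closed_family:
  assumes F: "F \<subseteq> K" "\<And>A B. A \<in> F \<Longrightarrow> B \<in> F \<Longrightarrow> A \<inter> B \<in> F"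
  shows "\<exists>G. F \<subseteq> G \<and> G \<subseteq> K \<and> (\<forall>A\<in>G. \<forall>B\<in>G. A \<inter> B \<in> G) \<and>
    (\<forall>D. (\<forall>B\<in>G. B \<inter> D \<in> K) \<longrightarrow> (\<forall>A\<in>G. A \<inter> D \<in> G))"
proof -
  define Z where "Z = {G. F \<subseteq> G \<and> G \<subseteq> K \<and> (\<forall>A\<in>G. \<forall>B\<in>G. A \<inter> B \<in> G)}"
  have "\<exists>G\<in>Z. \<forall>H\<in>Z. G \<subseteq> H \<longrightarrow> H = G"
  proof (rule subset_Zorn_nonempty)
    show "Z \<noteq> {}" using F unfolding Z_def by blast
  next
    fix C assume C: "C \<noteq> {}" "subset.chain Z C"
    then have sub: "C \<subseteq> Z" and lin: "\<And>G H. G \<in> C \<Longrightarrow> H \<in> C \<Longrightarrow> G \<subseteq> H \<or> H \<subseteq> G"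
      by (auto simp: subset.chain_def)
    have "A \<inter> B \<in> \<Union>C" if AB: "A \<in> \<Union>C" "B \<in> \<Union>C" for A B
    proof -
      obtain G H where "G \<in> C" "A \<in> G" "H \<in> C" "B \<in> H" using AB by blast
      then obtain I where "I \<in> C" "A \<in> I" "B \<in> I" using lin by blast
      then show ?thesis using sub unfolding Z_def by blast
    qed
    moreover have "F \<subseteq> \<Union>C" using C(1) sub unfolding Z_def by blast
    moreover have "\<Union>C \<subseteq> K" using sub unfolding Z_def by blast
    ultimately show "\<Union>C \<in> Z" unfolding Z_def by blast
  qed
  then obtain G where G: "G \<in> Z" and mx: "\<And>H. H \<in> Z \<Longrightarrow> G \<subseteq> H \<Longrightarrow> H = G" by blast
  have GI: "\<And>A B. A \<in> G \<Longrightarrow> B \<in> G \<Longrightarrow> A \<inter> B \<in> G" and GK: "F \<subseteq> G" "G \<subseteq> K"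
    using G unfolding Z_def by auto
  have "A \<inter> D \<in> G" if D: "\<And>B. B \<in> G \<Longrightarrow> B \<inter> D \<in> K" and A: "A \<in> G" for A D
  proof -
    let ?H = "G \<union> (\<lambda>B. B \<inter> D) ` G"
    have "A \<inter> B \<in> ?H" if AB: "A \<in> ?H" "B \<in> ?H" for A B
    proof -
      obtain A' B' where "A' \<in> G" "A = A' \<or> A = A' \<inter> D" "B' \<in> G" "B = B' \<or> B = B' \<inter> D"
        using AB by blast
      moreover from this have "A \<inter> B = A' \<inter> B' \<or> A \<inter> B = A' \<inter> B' \<inter> D" by auto
      ultimately show ?thesis using GI by auto
    qed
    then have "?H \<in> Z" unfolding Z_def using GK D by auto
    then have "?H = G" using mx by blast
    then show ?thesis using A by blast
  qed
  then show ?thesis using GK GI by (intro exI[of _ G]) simp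
qed

locale free_ultrafilter =
  fixes U :: "nat filter"
  assumes proper: "U \<noteq> bot"
    and free: "U \<le> sequentially"
    and ultra: "eventually P U \<or> eventually (\<lambda>n. \<not> P n) U"
begin

lemma not_eventually_ultra: "\<not> eventually P U \<longleftrightarrow> eventually (\<lambda>n. \<not> P n) U"
  using ultra[of P] eventually_happens'[OF proper eventually_conj[of P U "\<lambda>n. \<not> P n"]] by auto

lemma eventually_ge: "eventually (\<lambda>n. p \<le> n) U"
  using free by (rule filter_leD) (rule eventually_ge_at_top)

lemma sequential_limit: "(f \<longlongrightarrow> l) sequentially \<Longrightarrow> (f \<longlongrightarrow> l) U"
  using free by (rule tendsto_mono)

lemma bounded_tendsto_Lim:
  fixes f :: "nat \<Rightarrow> real"
  assumes "\<And>n. f n \<in> {a..b}"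
  shows "(f \<longlongrightarrow> Lim U f) U"
proof -
  have "filtermap f U \<noteq> bot" "filtermap f U \<le> principal {a..b}"
    using proper assms by (auto simp: filtermap_bot_iff le_principal eventually_filtermap)
  then obtain l where l: "inf (nhds l) (filtermap f U) \<noteq> bot"
    using compact_Icc[of a b] unfolding compact_filter by (auto simp: le_principal)
  have "(f \<longlongrightarrow> l) U"
  proof (rule topological_tendstoI)
    \<comment> \<open>A cluster point of an ultrafilter is a limit: otherwise almost all values avoid a neighbourhood.\<close>
    fix S :: "real set" assume S: "open S" "l \<in> S"
    show "eventually (\<lambda>n. f n \<in> S) U"
    proof (rule ccontr)
      assume "\<not> ?thesis"
      then have "eventually (\<lambda>r. r \<notin> S) (filtermap f U)"
        by (simp add: not_eventually_ultra eventually_filtermap)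
      moreover have "eventually (\<lambda>r. r \<in> S) (nhds l)"
        using S by (rule eventually_nhds_in_open)
      ultimately have "eventually (\<lambda>r. False) (inf (nhds l) (filtermap f U))"
        unfolding eventually_inf by (metis (mono_tags, lifting))
      then show False using l by (simp add: eventually_False)
    qed
  qed
  then show ?thesis using tendsto_Lim[OF proper] by metis
qed

end

lemma free_ultrafilter_exists: "\<exists>U. free_ultrafilter U"
proof -
  let ?K = "{A :: nat set. infinite A}"
  have sub: "range atLeast \<subseteq> ?K" by (auto simp: infinite_Ici)
  have int: "A \<inter> B \<in> range atLeast" if AB: "A \<in> range atLeast" "B \<in> range atLeast" for A B :: "nat set"
  proof -
    obtain p q where "A = {p..}" "B = {q..}" using AB by blast
    then have "A \<inter> B = {max p q..}" by auto
    then show ?thesis by simp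
  qed
  obtain G where max: "range atLeast \<subseteq> G \<and> G \<subseteq> ?K \<and> (\<forall>A\<in>G. \<forall>B\<in>G. A \<inter> B \<in> G) \<and>
      (\<forall>D. (\<forall>B\<in>G. B \<inter> D \<in> ?K) \<longrightarrow> (\<forall>A\<in>G. A \<inter> D \<in> G))"
    using maximal_intersection_closed_family[OF sub int] by (rule exE)
  then have G: "range atLeast \<subseteq> G" "G \<subseteq> ?K" "\<And>A B. A \<in> G \<Longrightarrow> B \<in> G \<Longrightarrow> A \<inter> B \<in> G"
    by blast+
  have zero: "{0..} \<in> G" using G(1) by (rule subsetD) (rule rangeI)
  have extend: "A \<inter> D \<in> G" if D: "\<forall>B\<in>G. infinite (B \<inter> D)" and A: "A \<in> G" for A D
  proof -
    have "(\<forall>B\<in>G. B \<inter> D \<in> ?K) \<longrightarrow> (\<forall>A\<in>G. A \<inter> D \<in> G)" using max by (elim conjE) (rule spec)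
    then show ?thesis using A D by simp
  qed
  define U where "U = (INF A\<in>G. principal A)"
  have ev: "eventually P U \<longleftrightarrow> (\<exists>A\<in>G. \<forall>n\<in>A. P n)" for P
    unfolding U_def
    by (subst eventually_INF_base) (use G(1,3) in \<open>auto simp: eventually_principal\<close>)
  have "free_ultrafilter U"
  proof
    show "U \<noteq> bot"
    proof
      assume "U = bot"
      then have "eventually (\<lambda>n. False) U" by simp
      then have "{} \<in> G" unfolding ev by auto
      then show False using G(2) by auto
    qed
    show "U \<le> sequentially"
    proof (rule filter_leI)
      fix P :: "nat \<Rightarrow> bool" assume "eventually P sequentially"
      then obtain p where "\<forall>n\<in>{p..}. P n" by (auto simp: eventually_sequentially)
      then show "eventually P U" unfolding ev using G(1) by (intro bexI[of _ "{p..}"]) auto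
    qed
    fix P :: "nat \<Rightarrow> bool"
    show "eventually P U \<or> eventually (\<lambda>n. \<not> P n) U"
    proof (cases "\<forall>B\<in>G. infinite (B \<inter> {n. P n})")
      case True
      then have "{0..} \<inter> {n. P n} \<in> G" using zero by (rule extend)
      then show ?thesis unfolding ev by (intro disjI1 bexI[of _ "{0..} \<inter> {n. P n}"]) simp
    next
      case False
      then obtain B where B: "B \<in> G" "finite (B \<inter> {n. P n})" by blast
      have "infinite (A \<inter> {n. \<not> P n})" if "A \<in> G" for A
      proof
        assume "finite (A \<inter> {n. \<not> P n})"
        then have "finite ((A \<inter> {n. \<not> P n}) \<union> (B \<inter> {n. P n}))" using B by simp
        then have "finite (A \<inter> B)" by (rule rev_finite_subset) auto
        then show False using G(2) G(3)[OF that B(1)] by auto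
      qed
      then have "\<forall>A\<in>G. infinite (A \<inter> {n. \<not> P n})" by (rule ballI)
      then have "{0..} \<inter> {n. \<not> P n} \<in> G" using zero by (rule extend)
      then show ?thesis unfolding ev by (intro disjI2 bexI[of _ "{0..} \<inter> {n. \<not> P n}"]) simp
    qed
  qed
  then show ?thesis ..
qed

section \<open>Spreading functionals of nonsquare type\<close>

text \<open>
  The value of \<open>N\<close> on the list \<open>t\<^sub>1, ..., t\<^sub>n\<close> stands for the norm of \<open>t\<^sub>1 x\<^sub>k\<^sub>1 + ... + t\<^sub>n x\<^sub>k\<^sub>n\<close> in the
  limit of indices \<open>k\<^sub>1 < ... < k\<^sub>n\<close> that tend to infinity far apart. That only the order of the indices
  matters is the rule for inserting a zero. \<open>\<theta>\<close> bounds from below the distance between convex combinations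
  of an early and a late block of the sequence.
\<close>

locale spreading_functional =
  fixes M \<rho> \<theta> :: real and N :: "real list \<Rightarrow> real"
  assumes nonneg: "0 \<le> N us"
    and add: "length us = length vs \<Longrightarrow> N (map2 (+) us vs) \<le> N us + N vs"
    and scale: "N (map ((*) c) us) = \<bar>c\<bar> * N us"
    and insert_0: "N (us @ 0 # vs) = N (us @ vs)"
    and bound: "N us \<le> M * (\<Sum>t\<leftarrow>us. \<bar>t\<bar>)"
    and nonsquare: "length us = length vs \<Longrightarrow>
      min (N (map2 (+) us vs)) (N (map2 (-) us vs)) \<le> \<rho> * max (N us) (N vs)"
    and separated: "\<lbrakk>\<forall>a\<in>set us. 0 \<le> a; sum_list us = 1; \<forall>b\<in>set vs. 0 \<le> b; sum_list vs = 1\<rbrakk>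
      \<Longrightarrow> \<theta> \<le> N (us @ map uminus vs)"

definition halve :: "real list \<Rightarrow> real list" where
  "halve us = concat (map (\<lambda>t. [t / 2, t / 2]) us)"

lemma halve_simps [simp]: "halve [] = []" "halve (t # us) = t / 2 # t / 2 # halve us"
  by (simp_all add: halve_def)

lemma halve_append [simp]: "halve (us @ vs) = halve us @ halve vs"
  by (simp add: halve_def)

lemma length_halve [simp]: "length (halve us) = 2 * length us"
  by (induction us) auto

lemma sum_list_halve [simp]: "sum_list (halve us) = sum_list us"
  by (induction us) auto

lemma sum_list_abs_halve [simp]: "(\<Sum>t\<leftarrow>halve us. \<bar>t\<bar>) = (\<Sum>t\<leftarrow>us. \<bar>t\<bar>)"
  by (induction us) auto

lemma halve_nonneg: "\<forall>t\<in>set us. 0 \<le> t \<Longrightarrow> \<forall>t\<in>set (halve us). 0 \<le> t"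
  by (induction us) auto

lemma halve_map_uminus: "halve (map uminus us) = map uminus (halve us)"
  by (induction us) auto

lemma halve_map_scale: "halve (map ((*) c) us) = map ((*) c) (halve us)"
  by (induction us) auto

lemma halve_map2_add: "length us = length vs \<Longrightarrow> halve (map2 (+) us vs) = map2 (+) (halve us) (halve vs)"
  by (induction us vs rule: list_induct2) (auto simp: field_simps)

lemma halve_map2_diff: "length us = length vs \<Longrightarrow> halve (map2 (-) us vs) = map2 (-) (halve us) (halve vs)"
  by (induction us vs rule: list_induct2) (auto simp: field_simps)

context spreading_functional
begin

lemma average:
  assumes "length us = length vs"
  shows "N (map2 (\<lambda>a b. (a + b) / 2) us vs) \<le> (N us + N vs) / 2"
proof -
  have e: "map2 (\<lambda>a b. (a + b) / 2) us vs = map ((*) (1 / 2)) (map2 (+) us vs)"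
    using assms by (induction us vs rule: list_induct2) auto
  show ?thesis unfolding e scale using add[OF assms] by simp
qed

lemma insert_zeros: "N (us @ replicate k 0 @ vs) = N (us @ vs)"
  by (induction k) (simp_all add: insert_0)

text \<open>
  Inserting a zero on either side of the entry \<open>t\<close> gives two lists of equal value, and their average
  is the list in which \<open>t\<close> is split.
\<close>

lemma split_le: "N (us @ t / 2 # t / 2 # vs) \<le> N (us @ t # vs)"
proof -
  have e: "map2 (\<lambda>a b. (a + b) / 2) us us = us" for us :: "real list"
    by (induction us) auto
  have "us @ t / 2 # t / 2 # vs =
    map2 (\<lambda>a b. (a + b) / 2) (us @ t # 0 # vs) (us @ 0 # t # vs)"
    by (simp add: e)
  also have "N \<dots> \<le> (N (us @ t # 0 # vs) + N (us @ 0 # t # vs)) / 2"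
    by (rule average) simp
  also have "\<dots> = N (us @ t # vs)"
    using insert_0[of "us @ [t]" vs] insert_0[of us "t # vs"] by simp
  finally show ?thesis .
qed

lemma halve_middle_le: "N (us @ halve ws @ vs) \<le> N (us @ ws @ vs)"
proof (induction ws arbitrary: us)
  case (Cons t ws)
  have "N (us @ halve (t # ws) @ vs) \<le> N ((us @ [t / 2, t / 2]) @ ws @ vs)"
    using Cons.IH[of "us @ [t / 2, t / 2]"] by simp
  also have "\<dots> \<le> N (us @ t # ws @ vs)" using split_le[of us t "ws @ vs"] by simp
  finally show ?case by simp
qed simp

lemma halve_le: "N (halve us) \<le> N us"
  using halve_middle_le[of "[]" us "[]"] by simp

lemma spreading_functional_halve: "spreading_functional M \<rho> \<theta> (\<lambda>us. N (halve us))"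
proof
  show "N (halve (us @ 0 # vs)) = N (halve (us @ vs))" for us vs
    using insert_zeros[of "halve us" 2 "halve vs"] by (simp add: numeral_2_eq_2)
  show "N (halve us) \<le> M * (\<Sum>t\<leftarrow>us. \<bar>t\<bar>)" for us
    using bound[of "halve us"] by simp
  show "\<theta> \<le> N (halve (us @ map uminus vs))"
    if "\<forall>a\<in>set us. 0 \<le> a" "sum_list us = 1" "\<forall>b\<in>set vs. 0 \<le> b" "sum_list vs = 1" for us vs
    using separated[of "halve us" "halve vs"] that
    by (simp add: halve_map_uminus halve_nonneg)
qed (simp_all add: nonneg add scale nonsquare halve_map2_add halve_map2_diff halve_map_scale)

end

text \<open>
  Invariance under halving says that replacing the underlying sequence by averages of consecutive
  terms does not decrease the functional; it comes from iterating \<^const>\<open>halve\<close> and taking the limit.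
  Then splitting a single entry, which lies between splitting none and splitting all, changes nothing.
\<close>

locale halving_invariant = spreading_functional +
  assumes halve_eq: "N (halve us) = N us"
begin

lemma le_split: "N (us @ t # vs) \<le> N (us @ t / 2 # t / 2 # vs)"
proof -
  have "N (us @ t # vs) = N (halve us @ t / 2 # t / 2 # halve vs)"
    using halve_eq[of "us @ t # vs"] by simp
  also have "\<dots> \<le> N (us @ (t / 2 # t / 2 # halve vs))"
    using halve_middle_le[of "[]" us "t / 2 # t / 2 # halve vs"] by simp
  also have "\<dots> \<le> N (us @ t / 2 # t / 2 # vs)"
    using halve_middle_le[of "us @ [t / 2, t / 2]" vs "[]"] by simp
  finally show ?thesis .
qed

lemma le_halve_middle: "N (us @ ws @ vs) \<le> N (us @ halve ws @ vs)"
proof (induction ws arbitrary: us)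
  case (Cons t ws)
  have "N (us @ t # ws @ vs) \<le> N (us @ t / 2 # t / 2 # ws @ vs)" by (rule le_split)
  also have "\<dots> \<le> N (us @ halve (t # ws) @ vs)"
    using Cons.IH[of "us @ [t / 2, t / 2]"] by simp
  finally show ?case by simp
qed simp

lemma halve_replicate: "halve (replicate k t) = replicate (2 * k) (t / 2)"
  by (induction k) auto

lemma le_split_power: "N (us @ t # vs) \<le> N (us @ replicate (2 ^ m) (t / 2 ^ m) @ vs)"
proof (induction m)
  case (Suc m)
  also have "N (us @ replicate (2 ^ m) (t / 2 ^ m) @ vs) \<le>
      N (us @ halve (replicate (2 ^ m) (t / 2 ^ m)) @ vs)" by (rule le_halve_middle)
  finally show ?case by (simp add: halve_replicate mult.commute)
qed simp

text \<open>
  The average of a list and its shift by \<open>Suc k\<close> places: the shifted first entry falls on the last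
  entry of the unshifted copy, and the sum of the two is again \<open>\<alpha> + \<beta>\<close>, so the constant block goes on
  without interruption.
\<close>

lemma overlapping_average_le:
  "N (us @ \<alpha> / 2 # replicate (Suc (2 * k)) ((\<alpha> + \<beta>) / 2) @ \<beta> / 2 # vs)
     \<le> N (us @ \<alpha> # replicate k (\<alpha> + \<beta>) @ \<beta> # vs)"
proof -
  let ?R = "replicate k (\<alpha> + \<beta>)" and ?S = "replicate k ((\<alpha> + \<beta>) / 2)"
  let ?X = "us @ \<alpha> # ?R @ \<beta> # replicate k 0 @ 0 # vs"
    and ?Y = "us @ 0 # replicate k 0 @ \<alpha> # ?R @ \<beta> # vs"
  have e: "map2 (\<lambda>a b. (a + b) / 2) us us = us" for us :: "real list"
    by (induction us) auto
  have r: "map2 (\<lambda>a b. (a + b) / 2) (replicate k s) (replicate k t) = replicate k ((s + t) / 2)"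
    for k and s t :: real by (induction k) auto
  have "Suc (2 * k) = k + Suc k" by simp
  then have "us @ \<alpha> / 2 # replicate (Suc (2 * k)) ((\<alpha> + \<beta>) / 2) @ \<beta> / 2 # vs
      = us @ \<alpha> / 2 # ?S @ (\<alpha> + \<beta>) / 2 # ?S @ \<beta> / 2 # vs"
    by (simp only: replicate_add replicate_Suc append_Cons append_Nil append_assoc)
  also have "\<dots> = map2 (\<lambda>a b. (a + b) / 2) ?X ?Y"
    by (simp only: zip_append length_replicate map_append list.map zip_Cons_Cons prod.case e r
        append_Cons append_Nil add_0 add_0_right add.commute[of \<beta>])
  also have "N \<dots> \<le> (N ?X + N ?Y) / 2"
    by (rule average) simp
  also have "N ?X = N (us @ \<alpha> # ?R @ \<beta> # vs)"
    using insert_zeros[of "us @ \<alpha> # ?R @ [\<beta>]" "Suc k" vs] by (simp add: replicate_app_Cons_same)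
  also have "N ?Y = N (us @ \<alpha> # ?R @ \<beta> # vs)"
    using insert_zeros[of us "Suc k" "\<alpha> # ?R @ \<beta> # vs"] by simp
  finally show ?thesis by simp
qed

text \<open>
  Averaging the shifts of the adjacent pair \<open>a, b\<close> over \<open>2 ^ m\<close> places telescopes to a constant block
  with two small boundary entries.
\<close>

lemma shifted_average_le:
  "N (us @ a / 2 ^ m # replicate (2 ^ m - 1) ((a + b) / 2 ^ m) @ b / 2 ^ m # vs)
     \<le> N (us @ a # b # vs)"
proof (induction m)
  case (Suc m)
  have k: "2 ^ Suc m - 1 = Suc (2 * (2 ^ m - 1))"
    by (induction m) auto
  have ab: "(a + b) / 2 ^ m = a / 2 ^ m + b / 2 ^ m" by (rule add_divide_distrib)
  have h: "x / 2 ^ Suc m = x / 2 ^ m / 2" for x :: real by simp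
  from overlapping_average_le[of us "a / 2 ^ m" "2 ^ m - 1" "b / 2 ^ m" vs] Suc.IH
  show ?case unfolding k h ab by (rule order_trans)
qed simp

text \<open>
  After averaging over many shifts, \<open>a, b\<close> differs by a boundary term of order \<open>1 / 2 ^ m\<close> from
  \<open>a + b\<close> split into \<open>2 ^ m\<close> equal parts. The signs of \<open>a\<close> and \<open>b\<close> are arbitrary.
\<close>

lemma merge_le: "N (us @ (a + b) # vs) \<le> N (us @ a # b # vs)"
proof -
  have step: "N (us @ (a + b) # vs) \<le> N (us @ a # b # vs) + M * 2 * \<bar>a\<bar> / 2 ^ m" for m
  proof -
    define k where "k = (2 ^ m - 1 :: nat)"
    let ?n = "2 ^ m :: real"
    let ?R = "replicate k ((a + b) / ?n)"
    let ?D = "replicate (length us) 0 @ (- a / ?n) # replicate k 0 @ (a / ?n) # replicate (length vs) 0"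
    let ?X = "us @ a / ?n # ?R @ b / ?n # vs"
    have z: "map2 (+) us (replicate (length us) 0) = us" for us :: "real list"
      by (induction us) auto
    have r: "map2 (+) (replicate k s) (replicate k 0) = replicate k s" for k and s :: real
      by (induction k) auto
    have k: "2 ^ m = Suc k" by (simp add: k_def)
    have "N (us @ (a + b) # vs) \<le> N (us @ replicate (2 ^ m) ((a + b) / ?n) @ vs)"
      by (rule le_split_power)
    also have "us @ replicate (2 ^ m) ((a + b) / ?n) @ vs = us @ ?R @ (a + b) / ?n # vs"
      unfolding k by (simp add: replicate_app_Cons_same)
    also have "N \<dots> = N (us @ 0 # ?R @ (a + b) / ?n # vs)"
      by (rule insert_0[symmetric])
    also have "us @ 0 # ?R @ (a + b) / ?n # vs = map2 (+) ?X ?D"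
      by (simp add: z r add_divide_distrib add.commute)
    also have "N \<dots> \<le> N ?X + N ?D" by (rule add) simp
    also have "N ?D \<le> M * 2 * \<bar>a\<bar> / ?n"
      using bound[of ?D] by (simp add: sum_list_replicate)
    also have "N ?X \<le> N (us @ a # b # vs)" 
      using shifted_average_le[of us a m b vs] by (simp add: k_def)
    finally show ?thesis by simp
  qed
  have "(\<lambda>m. N (us @ a # b # vs) + M * 2 * \<bar>a\<bar> * (1 / 2) ^ m) \<longlonglongrightarrow>
      N (us @ a # b # vs) + M * 2 * \<bar>a\<bar> * 0"
    by (intro tendsto_intros) simp
  then have "(\<lambda>m. N (us @ a # b # vs) + M * 2 * \<bar>a\<bar> / 2 ^ m) \<longlonglongrightarrow> N (us @ a # b # vs)"
    by (simp add: power_one_over divide_simps)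
  then show ?thesis by (rule LIMSEQ_le_const) (use step in blast)
qed

end

text \<open>
  The list \<open>zigzag n\<close> is \<open>1, -2, 2, ...\<close> with \<open>n\<close> entries of modulus 2, closed by an entry of modulus 1
  that makes the sum vanish; \<open>oppose\<close> gives the difference of two interlaced copies of a list.
\<close>

primrec zigzag_tail :: "real \<Rightarrow> nat \<Rightarrow> real list" where
  "zigzag_tail s 0 = [s]"
| "zigzag_tail s (Suc n) = 2 * s # zigzag_tail (- s) n"

definition zigzag :: "nat \<Rightarrow> real list" where
  "zigzag n = 1 # zigzag_tail (- 1) n"

abbreviation oppose :: "real list \<Rightarrow> real list" where
  "oppose us \<equiv> concat (map (\<lambda>t. [t, - t]) us)"

lemma zigzag_tail_scale: "map ((*) c) (zigzag_tail s n) = zigzag_tail (c * s) n"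
  by (induction n arbitrary: s) auto

lemma sum_abs_zigzag_tail: "(\<Sum>t\<leftarrow>zigzag_tail s n. \<bar>t\<bar>) = (2 * real n + 1) * \<bar>s\<bar>"
  by (induction n arbitrary: s) (auto simp: algebra_simps)

context halving_invariant
begin

lemma zigzag_ge: "\<theta> \<le> N (zigzag 0)"
  using separated[of "[1]" "[1]"] by (simp add: zigzag_def)

text \<open>
  In \<open>oppose\<close> of an alternating list, the second entry of each pair has the sign of the first entry of
  the next pair, so the two merge; only the outer ends need extra care.
\<close>

lemma merge_zigzag_tail:
  "N (us @ zigzag_tail (2 * s) n) \<le> N (us @ 2 * s # oppose (zigzag_tail s n))"
proof (induction n arbitrary: us s)
  case 0
  have "N (us @ [2 * s]) = N (us @ (s + - s) # [2 * s])" using insert_0[of us] by simp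
  also have "\<dots> \<le> N (us @ s # - s # [2 * s])" by (rule merge_le)
  finally have *: "N (us @ [2 * s]) = N ((us @ [2 * s]) @ (s + - s) # [])" 
    using insert_0[of "us @ [2 * s]" "[]"] by simp
  also have "\<dots> \<le> N ((us @ [2 * s]) @ s # - s # [])" by (rule merge_le)
  finally show ?case by simp
next
  case (Suc n)
  have "N (us @ zigzag_tail (2 * s) (Suc n)) = N ((us @ [4 * s]) @ zigzag_tail (2 * - s) n)"
    by simp
  also have "\<dots> \<le> N ((us @ [4 * s]) @ 2 * - s # oppose (zigzag_tail (- s) n))"
    by (rule Suc.IH)
  also have "\<dots> = N (us @ (2 * s + 2 * s) # - (2 * s) # oppose (zigzag_tail (- s) n))"
    by simp
  also have "\<dots> \<le> N (us @ 2 * s # 2 * s # - (2 * s) # oppose (zigzag_tail (- s) n))"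
    by (rule merge_le)
  finally show ?case by simp
qed

lemma zigzag_oppose: "2 * N (zigzag n) \<le> N (oppose (zigzag (Suc n)))"
proof -
  have "map ((*) (- 2)) (zigzag n) = [- 2] @ zigzag_tail (2 * 1) n"
    by (simp add: zigzag_def zigzag_tail_scale)
  then have "2 * N (zigzag n) = N ([- 2] @ zigzag_tail (2 * 1) n)"
    using scale[of "- 2" "zigzag n"] by simp
  also have "\<dots> \<le> N ([- 2] @ 2 * 1 # oppose (zigzag_tail 1 n))"
    by (rule merge_zigzag_tail)
  also have "\<dots> = N ([] @ (0 + - 2) # 2 # oppose (zigzag_tail 1 n))" by simp
  also have "\<dots> \<le> N ([] @ 0 # - 2 # 2 # oppose (zigzag_tail 1 n))" by (rule merge_le)
  also have "\<dots> = N ([] @ (1 + - 1) # - 2 # 2 # oppose (zigzag_tail 1 n))" by simp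
  also have "\<dots> \<le> N ([] @ 1 # - 1 # - 2 # 2 # oppose (zigzag_tail 1 n))" by (rule merge_le)
  finally show ?thesis by (simp add: zigzag_def)
qed

text \<open>
  Two copies of the zigzag list of length parameter \<open>Suc n\<close>, placed on the even and on the odd
  positions, have the same value as the list itself. Their sum is twice its halving, their difference
  is its \<open>oppose\<close>, which dominates twice the next shorter zigzag list.
\<close>

lemma zigzag_growth:
  "N (zigzag n) \<le> N (zigzag (Suc n))"
  "\<rho> < 2 \<Longrightarrow> 0 < N (zigzag (Suc n)) \<Longrightarrow> 2 * N (zigzag n) \<le> \<rho> * N (zigzag (Suc n))"
proof -
  let ?P = "zigzag (Suc n)"
  let ?u = "concat (map (\<lambda>t. [t, 0]) ?P)" and ?v = "concat (map (\<lambda>t. [0, t]) ?P)"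
  have len: "length ?u = length ?v" by (simp add: length_concat comp_def)
  have "N (us @ concat (map (\<lambda>t. [t, 0]) P)) = N (us @ P)" for us P
  proof (induction P arbitrary: us)
    case (Cons t P)
    show ?case using insert_0[of "us @ [t]"] Cons.IH[of "us @ [t]"] by simp
  qed simp
  from this[of "[]"] have u: "N ?u = N ?P" by simp
  have "N (us @ concat (map (\<lambda>t. [0, t]) P)) = N (us @ P)" for us P
  proof (induction P arbitrary: us)
    case (Cons t P)
    show ?case using insert_0[of us] Cons.IH[of "us @ [t]"] by simp
  qed simp
  from this[of "[]"] have v: "N ?v = N ?P" by simp
  have "map2 (+) (concat (map (\<lambda>t. [t, 0]) P)) (concat (map (\<lambda>t. [0, t]) P)) = map ((*) 2) (halve P)"
    for P :: "real list" by (induction P) auto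
  then have sum: "N (map2 (+) ?u ?v) = 2 * N ?P"
    using scale[of 2 "halve ?P"] halve_eq[of ?P] by simp
  have "map2 (-) (concat (map (\<lambda>t. [t, 0]) P)) (concat (map (\<lambda>t. [0, t]) P)) = oppose P"
    for P :: "real list" by (induction P) auto
  then have diff: "2 * N (zigzag n) \<le> N (map2 (-) ?u ?v)" using zigzag_oppose[of n] by simp
  have "map2 (-) us vs = map2 (+) us (map ((*) (- 1)) vs)" if "length us = length vs"
    for us vs :: "real list" using that by (induction us vs rule: list_induct2) auto
  then have "N (map2 (-) ?u ?v) \<le> N ?u + N (map ((*) (- 1)) ?v)" using len by (simp add: add)
  then show "N (zigzag n) \<le> N (zigzag (Suc n))" using diff u v scale[of "- 1" ?v] by simp
  assume "\<rho> < 2" "0 < N ?P"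
  then have "\<rho> * N ?P < 2 * N ?P" by simp
  then show "2 * N (zigzag n) \<le> \<rho> * N ?P"
    using nonsquare[OF len] diff unfolding sum u v by simp
qed

text \<open>
  The values on the zigzag lists start at \<open>\<theta>\<close> or more, grow by a factor \<open>2 / \<rho>\<close> at each step, and are at
  most linear in the length.
\<close>

lemma not_separated_if_nonsquare:
  assumes "\<rho> < 2" "0 < \<theta>"
  shows False
proof -
  have pos: "\<theta> \<le> N (zigzag n)" for n
    by (induction n) (use zigzag_ge zigzag_growth(1) order_trans in blast)+
  have K: "N (zigzag n) \<le> \<rho> / 2 * N (zigzag (Suc n))" for n
    using zigzag_growth(2)[of n] pos[of "Suc n"] assms by simp
  have "0 < \<rho> / 2 * N (zigzag (Suc 0))" using K[of 0] pos[of 0] assms by linarith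
  then have q: "0 < \<rho> / 2" using nonneg by (simp add: zero_less_mult_iff) (metis not_less)
  have geo: "\<theta> \<le> (\<rho> / 2) ^ n * N (zigzag n)" for n
  proof (induction n)
    case (Suc n)
    also have "(\<rho> / 2) ^ n * N (zigzag n) \<le> (\<rho> / 2) ^ n * (\<rho> / 2 * N (zigzag (Suc n)))"
      using K q by (intro mult_left_mono) auto
    finally show ?case by (simp add: mult_ac)
  qed (use pos in simp)
  have "\<theta> \<le> (\<rho> / 2) ^ n * (M * (2 * real n + 2))" for n
  proof -
    have "N (zigzag n) \<le> M * (2 * real n + 2)"
      using bound[of "zigzag n"] by (simp add: zigzag_def sum_abs_zigzag_tail add.commute)
    then have "(\<rho> / 2) ^ n * N (zigzag n) \<le> (\<rho> / 2) ^ n * (M * (2 * real n + 2))"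
      using q by (intro mult_left_mono) auto
    with geo show ?thesis by (rule order_trans)
  qed
  then have le: "\<theta> \<le> 2 * M * (real n * (\<rho> / 2) ^ n) + 2 * M * (\<rho> / 2) ^ n" for n
    by (simp add: algebra_simps)
  have "(\<lambda>n. 2 * M * (real n * (\<rho> / 2) ^ n) + 2 * M * (\<rho> / 2) ^ n) \<longlonglongrightarrow> 2 * M * 0 + 2 * M * 0"
    using q assms by (intro tendsto_intros powser_times_n_limit_0) auto
  then have "\<theta> \<le> 2 * M * 0 + 2 * M * 0" by (rule LIMSEQ_le_const) (use le in blast)
  then show False using assms by simp
qed

end

text \<open>
  Halving preserves all axioms and decreases the functional, so its iterates converge to a functional
  that it leaves unchanged.
\<close>

lemma (in spreading_functional) halving_limit:
  obtains N' where "halving_invariant M \<rho> \<theta> N'"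
proof -
  define H where "H m us = N ((halve ^^ m) us)" for m us
  have S: "spreading_functional M \<rho> \<theta> (H m)" for m
  proof (induction m)
    case 0
    show ?case using spreading_functional_axioms by (simp add: H_def)
  next
    case (Suc m)
    show ?case using spreading_functional.spreading_functional_halve[OF Suc]
      by (simp add: H_def[abs_def] funpow_swap1)
  qed
  have dec: "H (Suc m) us \<le> H m us" for m us
    using halve_le by (simp add: H_def)
  have "\<exists>l. (\<lambda>m. H m us) \<longlonglongrightarrow> l" for us
    using decseq_convergent[of "\<lambda>m. H m us" 0] dec spreading_functional.nonneg[OF S]
    by (metis decseq_SucI)
  then obtain N' where lim: "\<And>us. (\<lambda>m. H m us) \<longlonglongrightarrow> N' us" by metis
  have "halving_invariant M \<rho> \<theta> N'"
  proof
    fix us vs :: "real list" and c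
    show "0 \<le> N' us"
      using lim by (rule LIMSEQ_le_const) (use spreading_functional.nonneg[OF S] in blast)
    show "N' (map ((*) c) us) = \<bar>c\<bar> * N' us"
    proof (rule LIMSEQ_unique[OF lim])
      show "(\<lambda>m. H m (map ((*) c) us)) \<longlonglongrightarrow> \<bar>c\<bar> * N' us"
        using tendsto_mult_left[OF lim] by (simp add: spreading_functional.scale[OF S])
    qed
    show "N' (us @ 0 # vs) = N' (us @ vs)"
      using LIMSEQ_unique[OF lim[of "us @ 0 # vs"]] lim[of "us @ vs"]
        spreading_functional.insert_0[OF S] by auto
    show "N' us \<le> M * (\<Sum>t\<leftarrow>us. \<bar>t\<bar>)"
      using lim by (rule LIMSEQ_le_const2) (use spreading_functional.bound[OF S] in blast)
    show "N' (halve us) = N' us"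
    proof (rule LIMSEQ_unique)
      show "(\<lambda>m. H (Suc m) us) \<longlonglongrightarrow> N' (halve us)"
        using lim[of "halve us"] by (simp add: H_def funpow_swap1)
      show "(\<lambda>m. H (Suc m) us) \<longlonglongrightarrow> N' us" using lim by (rule LIMSEQ_Suc)
    qed
    show "\<theta> \<le> N' (us @ map uminus vs)"
      if "\<forall>a\<in>set us. 0 \<le> a" "sum_list us = 1" "\<forall>b\<in>set vs. 0 \<le> b" "sum_list vs = 1"
      using lim by (rule LIMSEQ_le_const) (use spreading_functional.separated[OF S that] in blast)
    assume len: "length us = length vs"
    show "N' (map2 (+) us vs) \<le> N' us + N' vs"
      using lim tendsto_add[OF lim lim]
      by (rule LIMSEQ_le) (use spreading_functional.add[OF S len] in blast)
    show "min (N' (map2 (+) us vs)) (N' (map2 (-) us vs)) \<le> \<rho> * max (N' us) (N' vs)"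
      using tendsto_min[OF lim lim] tendsto_mult_left[OF tendsto_max[OF lim lim]]
      by (rule LIMSEQ_le) (use spreading_functional.nonsquare[OF S len] in blast)
  qed
  then show thesis by (rule that)
qed

lemma (in spreading_functional) separation_nonpos: "\<rho> < 2 \<Longrightarrow> \<theta> \<le> 0"
  using halving_limit halving_invariant.not_separated_if_nonsquare by (metis not_less)

section \<open>Nonsquareness and spreading models\<close>

definition nonsquare :: "'a::real_normed_vector itself \<Rightarrow> real \<Rightarrow> bool" where
  "nonsquare _ \<rho> \<longleftrightarrow> (\<forall>(x :: 'a) y r. norm x \<le> r \<longrightarrow> norm y \<le> r \<longrightarrow>
     min (norm (x + y)) (norm (x - y)) \<le> \<rho> * r)"

lemma nonsquareD:
  fixes x y :: "'a::real_normed_vector"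
  assumes "nonsquare TYPE('a) \<rho>" "norm x \<le> r" "norm y \<le> r"
  shows "norm (x + y) \<le> \<rho> * r \<or> norm (x - y) \<le> \<rho> * r"
  using assms unfolding nonsquare_def min_le_iff_disj by blast

text \<open>
  The iterated limit \<open>lim\<^sub>k\<^sub>1 lim\<^sub>k\<^sub>2 ...\<close> along \<open>U\<close> of the norm of \<open>y + t\<^sub>1 x\<^sub>k\<^sub>1 + t\<^sub>2 x\<^sub>k\<^sub>2 + ...\<close>, the
  innermost limit belonging to the last entry of the list.
\<close>

primrec iterated_norm :: "nat filter \<Rightarrow> (nat \<Rightarrow> 'a::real_normed_vector) \<Rightarrow> real list \<Rightarrow> 'a \<Rightarrow> real" where
  "iterated_norm U x [] y = norm y"
| "iterated_norm U x (t # ts) y = Lim U (\<lambda>k. iterated_norm U x ts (y + t *\<^sub>R x k))"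

locale bounded_sequence = free_ultrafilter +
  fixes x :: "nat \<Rightarrow> 'a::real_normed_vector" and M :: real
  assumes bounded: "norm (x k) \<le> M"
begin

abbreviation L :: "real list \<Rightarrow> 'a \<Rightarrow> real" where
  "L \<equiv> iterated_norm U x"

lemma norm_add_scaleR_le: "norm (y + t *\<^sub>R x k) \<le> norm y + M * \<bar>t\<bar>"
  using norm_triangle_ineq[of y "t *\<^sub>R x k"] mult_left_mono[OF bounded[of k], of "\<bar>t\<bar>"]
  by (simp add: mult.commute)

lemma L_bounds: "L ts y \<in> {0..norm y + M * (\<Sum>t\<leftarrow>ts. \<bar>t\<bar>)}"
proof (induction ts arbitrary: y)
  case (Cons t ts)
  let ?b = "norm y + M * (\<Sum>t\<leftarrow>t # ts. \<bar>t\<bar>)"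
  have b: "L ts (y + t *\<^sub>R x k) \<in> {0..?b}" for k
    using Cons.IH[of "y + t *\<^sub>R x k"] norm_add_scaleR_le[of y t k] by (auto simp: distrib_left)
  then have lim: "((\<lambda>k. L ts (y + t *\<^sub>R x k)) \<longlongrightarrow> L (t # ts) y) U"
    unfolding iterated_norm.simps by (rule bounded_tendsto_Lim)
  have "L (t # ts) y \<in> {0..?b}"
    using b by (intro Lim_in_closed_set[OF closed_atLeastAtMost _ proper lim]) (simp only: eventually_True)
  then show ?case .
qed simp

lemma L_tendsto: "((\<lambda>k. L ts (y + t *\<^sub>R x k)) \<longlongrightarrow> L (t # ts) y) U"
proof -
  have "L ts (y + t *\<^sub>R x k) \<in> {0..norm y + M * \<bar>t\<bar> + M * (\<Sum>t\<leftarrow>ts. \<bar>t\<bar>)}" for k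
    using L_bounds[of ts "y + t *\<^sub>R x k"] norm_add_scaleR_le[of y t k] by auto
  then show ?thesis unfolding iterated_norm.simps by (rule bounded_tendsto_Lim)
qed

lemma L_insert_0: "L (us @ 0 # vs) y = L (us @ vs) y"
proof (induction us arbitrary: y)
  case Nil
  show ?case using tendsto_Lim[OF proper tendsto_const] by simp
qed simp

lemma L_add:
  assumes "length us = length vs"
  shows "L (map2 (+) us vs) (y + z) \<le> L us y + L vs z"
  using assms
proof (induction us vs arbitrary: y z rule: list_induct2)
  case (Cons s us t vs)
  have e: "y + z + (s + t) *\<^sub>R x k = (y + s *\<^sub>R x k) + (z + t *\<^sub>R x k)" for k
    by (simp add: scaleR_add_left)
  have "((\<lambda>k. L (map2 (+) us vs) (y + z + (s + t) *\<^sub>R x k)) \<longlongrightarrow>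
      L ((s + t) # map2 (+) us vs) (y + z)) U" by (rule L_tendsto)
  then have "L ((s + t) # map2 (+) us vs) (y + z) \<le> L (s # us) y + L (t # vs) z"
    by (rule tendsto_le[OF proper tendsto_add[OF L_tendsto L_tendsto]])
      (unfold e, intro always_eventually allI Cons.IH)
  then show ?case by simp
qed (simp add: norm_triangle_ineq)

lemma L_scale: "L (map ((*) c) us) (c *\<^sub>R y) = \<bar>c\<bar> * L us y"
proof (induction us arbitrary: y)
  case (Cons t us)
  have "c *\<^sub>R y + (c * t) *\<^sub>R x k = c *\<^sub>R (y + t *\<^sub>R x k)" for k by (simp add: scaleR_add_right)
  then have "((\<lambda>k. \<bar>c\<bar> * L us (y + t *\<^sub>R x k)) \<longlongrightarrow> L (map ((*) c) (t # us)) (c *\<^sub>R y)) U"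
    using L_tendsto[of "map ((*) c) us" "c *\<^sub>R y" "c * t"] Cons.IH by simp
  then show ?case using tendsto_unique[OF proper _ tendsto_mult_left[OF L_tendsto]] by blast
qed simp

lemma L_nonsquare:
  assumes "length us = length vs" and "nonsquare TYPE('a) \<rho>"
  shows "min (L (map2 (+) us vs) (y + z)) (L (map2 (-) us vs) (y - z)) \<le> \<rho> * max (L us y) (L vs z)"
  using assms(1)
proof (induction us vs arbitrary: y z rule: list_induct2)
  case Nil
  show ?case using assms(2) by (simp add: nonsquare_def)
next
  case (Cons s us t vs)
  have e: "y + z + (s + t) *\<^sub>R x k = (y + s *\<^sub>R x k) + (z + t *\<^sub>R x k)"
    "y - z + (s - t) *\<^sub>R x k = (y + s *\<^sub>R x k) - (z + t *\<^sub>R x k)" for k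
    by (simp_all add: algebra_simps)
  have "((\<lambda>k. min (L (map2 (+) us vs) (y + z + (s + t) *\<^sub>R x k))
      (L (map2 (-) us vs) (y - z + (s - t) *\<^sub>R x k))) \<longlongrightarrow>
      min (L ((s + t) # map2 (+) us vs) (y + z)) (L ((s - t) # map2 (-) us vs) (y - z))) U"
    by (intro tendsto_min L_tendsto)
  then have "min (L ((s + t) # map2 (+) us vs) (y + z)) (L ((s - t) # map2 (-) us vs) (y - z))
      \<le> \<rho> * max (L (s # us) y) (L (t # vs) z)"
    by (rule tendsto_le[OF proper tendsto_mult_left[OF tendsto_max[OF L_tendsto L_tendsto]]])
      (unfold e, intro always_eventually allI Cons.IH)
  then show ?case by simp
qed

text \<open>
  Since \<open>U\<close> contains all final segments, each limit may be restricted to indices beyond the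
  preceding ones, so that only increasing index lists have to be considered.
\<close>

lemma L_lower_bound:
  assumes "\<And>ks. length ks = length ts \<Longrightarrow> sorted_wrt (<) ks \<Longrightarrow> \<forall>k\<in>set ks. p \<le> k
    \<Longrightarrow> c \<le> norm (y + (\<Sum>i<length ts. (ts ! i) *\<^sub>R x (ks ! i)))"
  shows "c \<le> L ts y"
  using assms
proof (induction ts arbitrary: y p)
  case Nil
  show ?case using Nil[of "[]"] by simp
next
  case (Cons t ts)
  show ?case
  proof (rule tendsto_lowerbound[OF L_tendsto _ proper])
    show "eventually (\<lambda>k. c \<le> L ts (y + t *\<^sub>R x k)) U"
      using eventually_ge[of p]
    proof eventually_elim
      case (elim k)
      show ?case
      proof (rule Cons.IH[of "Suc k"])
        fix ks assume ks: "length ks = length ts" "sorted_wrt (<) ks" "\<forall>j\<in>set ks. Suc k \<le> j"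
        have "c \<le> norm (y + (\<Sum>i<length (t # ts). ((t # ts) ! i) *\<^sub>R x ((k # ks) ! i)))"
          using ks elim by (intro Cons.prems) auto
        then show "c \<le> norm (y + t *\<^sub>R x k + (\<Sum>i<length ts. (ts ! i) *\<^sub>R x (ks ! i)))"
          by (simp add: sum.lessThan_Suc_shift add.assoc del: sum.lessThan_Suc)
      qed
    qed
  qed
qed

lemma spreading_model:
  assumes ns: "nonsquare TYPE('a) \<rho>"
    and sep: "\<And>p u v. u \<in> convex hull (x ` {..<p}) \<Longrightarrow> v \<in> convex hull (x ` {p..}) \<Longrightarrow> \<theta> \<le> norm (u - v)"
  shows "spreading_functional M \<rho> \<theta> (\<lambda>us. L us 0)"
proof
  fix us vs :: "real list" and c
  show "0 \<le> L us 0" "L us 0 \<le> M * (\<Sum>t\<leftarrow>us. \<bar>t\<bar>)" using L_bounds[of us 0] by auto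
  show "L (map ((*) c) us) 0 = \<bar>c\<bar> * L us 0" using L_scale[of c us 0] by simp
  show "L (us @ 0 # vs) 0 = L (us @ vs) 0" by (rule L_insert_0)
  show "length us = length vs \<Longrightarrow> L (map2 (+) us vs) 0 \<le> L us 0 + L vs 0"
    using L_add[of us vs 0 0] by simp
  show "length us = length vs \<Longrightarrow> min (L (map2 (+) us vs) 0) (L (map2 (-) us vs) 0) \<le> \<rho> * max (L us 0) (L vs 0)"
    using L_nonsquare[OF _ ns, of us vs 0 0] by simp
  assume us: "\<forall>a\<in>set us. 0 \<le> a" "sum_list us = 1" and vs: "\<forall>b\<in>set vs. 0 \<le> b" "sum_list vs = 1"
  show "\<theta> \<le> L (us @ map uminus vs) 0"
  proof (rule L_lower_bound[where p = 0])
    fix ks :: "nat list" assume ks: "length ks = length (us @ map uminus vs)" "sorted_wrt (<) ks"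
    let ?m = "length us" and ?n = "length vs"
    \<comment> \<open>The positive coefficients sit on indices below \<open>p\<close>, the negative ones on indices from \<open>p\<close> on.\<close>
    define p where "p = ks ! ?m"
    have lt: "i < j \<Longrightarrow> j < ?m + ?n \<Longrightarrow> ks ! i < ks ! j" for i j
      using ks sorted_wrt_nth_less by fastforce
    have "?n \<noteq> 0" using vs by auto
    let ?u = "\<Sum>i<?m. (us ! i) *\<^sub>R x (ks ! i)" and ?v = "\<Sum>i<?n. (vs ! i) *\<^sub>R x (ks ! (?m + i))"
    have "?u \<in> convex hull (x ` {..<p})"
    proof (rule convex_sum)
      show "(\<Sum>i<?m. us ! i) = 1" using us by (simp add: sum_list_sum_nth atLeast0LessThan)
      show "0 \<le> us ! i" if "i \<in> {..<?m}" for i using us that by simp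
      show "x (ks ! i) \<in> convex hull (x ` {..<p})" if "i \<in> {..<?m}" for i
        using that lt[of i ?m] \<open>?n \<noteq> 0\<close> by (intro hull_inc) (auto simp: p_def)
    qed auto
    moreover have "?v \<in> convex hull (x ` {p..})"
    proof (rule convex_sum)
      show "(\<Sum>i<?n. vs ! i) = 1" using vs by (simp add: sum_list_sum_nth atLeast0LessThan)
      show "0 \<le> vs ! i" if "i \<in> {..<?n}" for i using vs that by simp
      show "x (ks ! (?m + i)) \<in> convex hull (x ` {p..})" if "i \<in> {..<?n}" for i
        using that lt[of ?m "?m + i"] by (intro hull_inc, cases "i = 0") (auto simp: p_def less_imp_le)
    qed auto
    ultimately have "\<theta> \<le> norm (?u - ?v)" by (rule sep)
    also have "?u - ?v = 0 + (\<Sum>i<length (us @ map uminus vs). ((us @ map uminus vs) ! i) *\<^sub>R x (ks ! i))"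
      by (simp add: lessThan_atLeast0 sum.atLeastLessThan_concat[of 0 ?m "?m + ?n", symmetric]
          sum.shift_bounds_nat_ivl[of _ 0 ?m ?n, simplified, simplified add.commute[of _ ?m]]
          nth_append sum_negf)
    finally show "\<theta> \<le> norm (0 + (\<Sum>i<length (us @ map uminus vs). ((us @ map uminus vs) ! i) *\<^sub>R x (ks ! i)))" .
  qed
qed

end

text \<open>
  The combinatorial core of James's theorem that uniformly nonsquare spaces are reflexive.
\<close>

theorem nonsquare_not_separated:
  fixes x :: "nat \<Rightarrow> 'a::real_normed_vector"
  assumes "nonsquare TYPE('a) \<rho>" "\<rho> < 2" "\<And>k. norm (x k) \<le> M"
    and "\<And>p u v. u \<in> convex hull (x ` {..<p}) \<Longrightarrow> v \<in> convex hull (x ` {p..}) \<Longrightarrow> \<theta> \<le> norm (u - v)"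
  shows "\<theta> \<le> 0"
proof -
  obtain U where "free_ultrafilter U" using free_ultrafilter_exists ..
  then interpret bounded_sequence U x M
    using assms(3) by (intro bounded_sequence.intro bounded_sequence_axioms.intro)
  show ?thesis
    using spreading_functional.separation_nonpos[OF spreading_model assms(2)] assms(1,4) by blast
qed

text \<open>
  The James constant speaks of unit vectors. If two vectors of the unit ball have sum and difference
  of norm above \<open>2 - \<eta>\<close>, both have norm above \<open>1 - \<eta>\<close>, and normalising them costs at most \<open>2 \<eta>\<close> in each
  norm; the choice \<open>J = 2 - 4 \<eta>\<close> makes this exceed the constant \<open>J\<close>. In the trivial space every \<open>\<rho>\<close>
  will do.
\<close>

lemma nonsquare_if_james_constant_ne_2:
  assumes "james_constant TYPE('a::real_normed_vector) \<noteq> 2"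
  shows "\<exists>\<rho><2. nonsquare TYPE('a) \<rho>"
proof (cases "sphere 0 1 = ({} :: 'a set)")
  case True
  have "x = 0" for x :: 'a
  proof (rule ccontr)
    assume "x \<noteq> 0"
    then have "x /\<^sub>R norm x \<in> sphere 0 1" by simp
    then show False using True by blast
  qed
  then have n: "norm x = 0" for x :: 'a by (metis norm_zero)
  have "nonsquare TYPE('a) 1" unfolding nonsquare_def
  proof (intro allI impI)
    fix x y :: 'a and r assume "norm x \<le> r"
    then show "min (norm (x + y)) (norm (x - y)) \<le> 1 * r" using n[of x] n[of "x + y"] by linarith
  qed
  then show ?thesis by (intro exI[of _ 1]) simp
next
  case False
  let ?A = "{min (norm (x + y)) (norm (x - y)) | x y :: 'a. x \<in> sphere 0 1 \<and> y \<in> sphere 0 1}"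
  let ?J = "james_constant TYPE('a)"
  have le2: "m \<le> 2" if m: "m \<in> ?A" for m
  proof -
    obtain x y :: 'a where xy: "m = min (norm (x + y)) (norm (x - y))" "norm x = 1" "norm y = 1"
      using m by auto
    then show ?thesis using norm_triangle_ineq[of x y] by linarith
  qed
  have "?A \<noteq> {}" using False by blast
  then have "?J \<le> 2" unfolding james_constant_def using le2 by (rule cSup_least)
  then have J: "?J < 2" using assms by simp
  have sphere: "min (norm (x + y)) (norm (x - y)) \<le> ?J" if "norm x = 1" "norm y = 1" for x y :: 'a
    unfolding james_constant_def
    by (rule cSup_upper) (use that le2 in \<open>auto intro!: bdd_aboveI[of _ 2]\<close>)
  obtain e :: 'a where "norm e = 1" using False by auto
  then have "0 \<le> ?J" using sphere[of e e] by simp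
  define \<eta> where "\<eta> = (2 - ?J) / 4"
  have \<eta>: "0 < \<eta>" "?J = 2 - 4 * \<eta>" using J by (simp_all add: \<eta>_def field_simps)
  have ball: "min (norm (x + y)) (norm (x - y)) \<le> 2 - \<eta>" if xy: "norm x \<le> 1" "norm y \<le> 1" for x y :: 'a
  proof (rule ccontr)
    assume "\<not> ?thesis"
    then have big: "2 - \<eta> < norm (x + y)" "2 - \<eta> < norm (x - y)" by auto
    then have n: "1 - \<eta> < norm x" "1 - \<eta> < norm y" using norm_triangle_ineq[of x y] xy by linarith+
    have "x \<noteq> 0" "y \<noteq> 0" using n \<eta>(2) \<open>0 \<le> ?J\<close> by auto
    have close: "norm (z - z /\<^sub>R norm z) \<le> \<eta>" if z: "norm z \<le> 1" "1 - \<eta> < norm z" "z \<noteq> 0" for z :: 'a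
    proof -
      have "z - z /\<^sub>R norm z = (1 - 1 / norm z) *\<^sub>R z" by (simp add: algebra_simps divide_inverse)
      then have "norm (z - z /\<^sub>R norm z) = \<bar>(1 - 1 / norm z) * norm z\<bar>" by (simp add: abs_mult)
      also have "(1 - 1 / norm z) * norm z = norm z - 1" using z by (simp add: algebra_simps)
      finally show ?thesis using z by simp
    qed
    let ?x = "x /\<^sub>R norm x" and ?y = "y /\<^sub>R norm y"
    have c: "norm (x - ?x) \<le> \<eta>" "norm (y - ?y) \<le> \<eta>" using close n xy \<open>x \<noteq> 0\<close> \<open>y \<noteq> 0\<close> by blast+
    have "x + y = (?x + ?y) + ((x - ?x) + (y - ?y))" "x - y = (?x - ?y) + ((x - ?x) - (y - ?y))" by simp_all
    then have "norm (x + y) \<le> norm (?x + ?y) + 2 * \<eta>" "norm (x - y) \<le> norm (?x - ?y) + 2 * \<eta>"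
      using norm_triangle_ineq[of "?x + ?y" "(x - ?x) + (y - ?y)"] norm_triangle_ineq[of "x - ?x" "y - ?y"]
        norm_triangle_ineq[of "?x - ?y" "(x - ?x) - (y - ?y)"] norm_triangle_ineq4[of "x - ?x" "y - ?y"] c
      by (auto simp del: add_diff_cancel diff_add_cancel)
    moreover have "min (norm (?x + ?y)) (norm (?x - ?y)) \<le> ?J"
      using \<open>x \<noteq> 0\<close> \<open>y \<noteq> 0\<close> by (intro sphere) auto
    ultimately show False using big \<eta> by linarith
  qed
  have "nonsquare TYPE('a) (2 - \<eta>)" unfolding nonsquare_def
  proof (intro allI impI)
    fix x y :: 'a and r assume xy: "norm x \<le> r" "norm y \<le> r"
    show "min (norm (x + y)) (norm (x - y)) \<le> (2 - \<eta>) * r"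
    proof (cases "r = 0")
      case False
      then have r: "0 < r" using xy norm_ge_zero[of x] by linarith
      have "min (norm (x /\<^sub>R r + y /\<^sub>R r)) (norm (x /\<^sub>R r - y /\<^sub>R r)) \<le> 2 - \<eta>"
        using xy r by (intro ball) (auto simp: field_simps)
      moreover have "norm (x /\<^sub>R r + y /\<^sub>R r) = norm (x + y) / r" "norm (x /\<^sub>R r - y /\<^sub>R r) = norm (x - y) / r"
        using r by (simp_all add: divide_inverse flip: scaleR_add_right scaleR_diff_right)
      ultimately have "norm (x + y) / r \<le> 2 - \<eta> \<or> norm (x - y) / r \<le> 2 - \<eta>"
        by (simp only: min_le_iff_disj)
      then show ?thesis using r by (auto simp: min_le_iff_disj pos_divide_le_eq)
    qed (use xy in simp)
  qed
  then show ?thesis using \<eta>(1) by (intro exI[of _ "2 - \<eta>"]) simp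
qed

section \<open>Compactness with respect to convex sets\<close>

text \<open>
  For Banach spaces this is reflexivity, since bounded closed convex sets are compact for the weak
  topology exactly in reflexive spaces. It is stated through directed families of convex sets because
  this is the form in which it is proved and used; no continuous functionals are involved.
\<close>

definition convexly_compact :: "'a::real_normed_vector itself \<Rightarrow> bool" where
  "convexly_compact _ \<longleftrightarrow> (\<forall>F :: 'a set set.
     F \<noteq> {} \<and> (\<forall>A\<in>F. closed A \<and> convex A \<and> bounded A \<and> A \<noteq> {}) \<and>
     (\<forall>A\<in>F. \<forall>B\<in>F. \<exists>C\<in>F. C \<subseteq> A \<inter> B) \<longrightarrow> \<Inter>F \<noteq> {})"

lemma norm_tendsto_0_if_le_harmonic:
  assumes "\<And>n. norm (f n) \<le> K / real (Suc n)"
  shows "(\<lambda>n. norm (f n)) \<longlonglongrightarrow> 0"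
proof (rule real_tendsto_sandwich)
  show "eventually (\<lambda>n. 0 \<le> norm (f n)) sequentially" by simp
  show "eventually (\<lambda>n. norm (f n) \<le> K / real (Suc n)) sequentially"
    using assms by (intro always_eventually allI)
  show "(\<lambda>n. K / real (Suc n)) \<longlonglongrightarrow> 0"
    using tendsto_mult_left[OF LIMSEQ_Suc[OF lim_1_over_n], of K] by (simp only: times_divide_eq_right mult_1_right mult_zero_right)
qed simp

lemma finite_Inter_in_family:
  assumes "\<And>A B. A \<in> G \<Longrightarrow> B \<in> G \<Longrightarrow> A \<inter> B \<in> G" "B \<in> G" "finite D" "\<And>y. y \<in> D \<Longrightarrow> f y \<in> G"
  shows "B \<inter> (\<Inter>y\<in>D. f y) \<in> G"
  using assms(3,4)
proof (induction D rule: finite_induct)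
  case (insert y D)
  then have "f y \<inter> (B \<inter> (\<Inter>y\<in>D. f y)) \<in> G" using assms(1) by simp
  then show ?case by (simp add: Int_left_commute)
qed (use assms(2) in simp)


text \<open>
  Enlarge the directed family to a maximal one, \<open>G\<close>. If some balls of arbitrarily small radius meet all
  members of \<open>G\<close>, their centres converge to a common point, because by maximality \<open>G\<close> contains the
  traces of these balls. Otherwise some \<open>e\<close> is such that every point has distance at least \<open>e\<close> from some
  member of \<open>G\<close>; by compactness a single member keeps distance \<open>e / 2\<close> from the convex hull of any given
  finite set, and choosing points successively in such members gives a separated sequence.
\<close>

lemma convexly_compact_if_nonsquare:
  assumes ns: "nonsquare TYPE('a::banach) \<rho>" "\<rho> < 2"
  shows "convexly_compact TYPE('a)"
  unfolding convexly_compact_def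
proof (intro allI impI, elim conjE)
  fix F :: "'a set set"
  assume F: "F \<noteq> {}" "\<forall>A\<in>F. closed A \<and> convex A \<and> bounded A \<and> A \<noteq> {}"
    and dir: "\<forall>A\<in>F. \<forall>B\<in>F. \<exists>C\<in>F. C \<subseteq> A \<inter> B"
  define K where "K = {A :: 'a set. closed A \<and> convex A \<and> bounded A \<and> A \<noteq> {}}"
  define F' where "F' = {S\<in>K. \<exists>A\<in>F. A \<subseteq> S}"
  have sub: "F' \<subseteq> K" by (auto simp: F'_def)
  have int: "A \<inter> B \<in> F'" if AB: "A \<in> F'" "B \<in> F'" for A B
  proof -
    obtain A' B' where sub: "A' \<in> F" "A' \<subseteq> A" "B' \<in> F" "B' \<subseteq> B" using AB by (auto simp: F'_def)
    obtain C where C: "C \<in> F" "C \<subseteq> A' \<inter> B'"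
      using dir[THEN bspec, OF sub(1), THEN bspec, OF sub(3)] by (rule bexE)
    then have C: "C \<in> F" "C \<subseteq> A \<inter> B" using sub by auto
    then have "A \<inter> B \<noteq> {}" using F(2) by auto
    then have "A \<inter> B \<in> K" using AB by (auto simp: F'_def K_def convex_Int bounded_Int)
    then show ?thesis using C by (auto simp: F'_def)
  qed
  obtain G where max: "F' \<subseteq> G \<and> G \<subseteq> K \<and> (\<forall>A\<in>G. \<forall>B\<in>G. A \<inter> B \<in> G) \<and>
      (\<forall>D. (\<forall>B\<in>G. B \<inter> D \<in> K) \<longrightarrow> (\<forall>A\<in>G. A \<inter> D \<in> G))"
    using maximal_intersection_closed_family[OF sub int] by (rule exE)
  from max have G: "F' \<subseteq> G" by (rule conjunct1)
  from max have "G \<subseteq> K" by (rule conjunct1[OF conjunct2])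
  note G = G this
  have GI: "A \<inter> B \<in> G" if "A \<in> G" "B \<in> G" for A B using max that by simp
  have mx: "A \<inter> D \<in> G" if "\<forall>B\<in>G. B \<inter> D \<in> K" "A \<in> G" for A D using max that by simp
  have "F \<subseteq> F'" using F by (auto simp: F'_def K_def)
  then have FG: "F \<subseteq> G" using G by blast
  then obtain A0 where A0: "A0 \<in> G" using F by blast
  have GK: "closed A" "convex A" "bounded A" "A \<noteq> {}" if "A \<in> G" for A
    using G that by (auto simp: K_def)
  have cut: "A \<inter> cball y e \<in> G" if y: "\<forall>B\<in>G. B \<inter> cball y e \<noteq> {}" and A: "A \<in> G" for A y e
  proof (rule mx[OF _ A])
    show "\<forall>B\<in>G. B \<inter> cball y e \<in> K"
      using y GK by (simp add: K_def convex_Int bounded_Int closed_Int)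
  qed
  have "\<Inter>G \<noteq> {}"
  proof (cases "\<forall>e>0. \<exists>y. \<forall>B\<in>G. B \<inter> cball y e \<noteq> {}")
    case True
    then have "\<forall>k. \<exists>y. \<forall>B\<in>G. B \<inter> cball y (1 / real (Suc k)) \<noteq> {}" by simp
    then obtain y where y: "\<And>k. \<forall>B\<in>G. B \<inter> cball (y k) (1 / real (Suc k)) \<noteq> {}" by metis
    have dist: "dist (y j) (y k) \<le> 1 / real (Suc j) + 1 / real (Suc k)" for j k
    proof -
      have "A0 \<inter> cball (y j) (1 / real (Suc j)) \<inter> cball (y k) (1 / real (Suc k)) \<in> G"
        by (intro cut y A0)
      then obtain a where "dist (y j) a \<le> 1 / real (Suc j)" "dist (y k) a \<le> 1 / real (Suc k)"
        using GK(4) by fastforce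
      then show ?thesis using dist_triangle2[of "y j" "y k" a] by linarith
    qed
    have "Cauchy y"
    proof (rule metric_CauchyI)
      fix e :: real assume "0 < e"
      then obtain n where n: "1 / real (Suc n) < e / 2" using nat_approx_posE[of "e / 2"] by auto
      have "dist (y j) (y k) < e" if "n \<le> j" "n \<le> k" for j k
      proof -
        have "1 / real (Suc j) \<le> 1 / real (Suc n)" "1 / real (Suc k) \<le> 1 / real (Suc n)"
          using that by (simp_all add: frac_le)
        then show ?thesis using dist[of j k] n by linarith
      qed
      then show "\<exists>n. \<forall>j\<ge>n. \<forall>k\<ge>n. dist (y j) (y k) < e" by blast
    qed
    then obtain l where l: "y \<longlonglongrightarrow> l" using Cauchy_convergent_iff convergent_def by blast
    have "l \<in> A" if A: "A \<in> G" for A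
    proof -
      have "\<forall>k. \<exists>a. a \<in> A \<and> dist (y k) a \<le> 1 / real (Suc k)" using y A by fastforce
      then obtain a where a: "\<And>k. a k \<in> A" "\<And>k. dist (y k) (a k) \<le> 1 / real (Suc k)" by metis
      have "norm (a k - y k) \<le> 1 / real (Suc k)" for k
        using a(2)[of k] unfolding dist_norm by (subst norm_minus_commute)
      then have "(\<lambda>k. norm (a k - y k)) \<longlonglongrightarrow> 0" by (rule norm_tendsto_0_if_le_harmonic)
      then have "(\<lambda>k. a k - y k) \<longlonglongrightarrow> 0" by (rule tendsto_norm_zero_cancel)
      then have "a \<longlonglongrightarrow> l" using tendsto_add[OF l] by fastforce
      then show ?thesis using closed_sequentially[OF GK(1)[OF A]] a by blast
    qed
    then show ?thesis by blast
  next
    case False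
    then obtain e where e: "0 < e" "\<forall>y. \<exists>B\<in>G. B \<inter> cball y e = {}" by blast
    then obtain Av where Av: "\<And>y. Av y \<in> G" "\<And>y. Av y \<inter> cball y e = {}" by metis
    have "\<exists>A\<in>G. \<forall>u\<in>convex hull S. \<forall>v\<in>A. e / 2 \<le> norm (u - v)" if S: "finite S" for S
    proof -
      have "convex hull S \<subseteq> (\<Union>y\<in>convex hull S. ball y (e / 2))" using e by auto
      then obtain D where D: "D \<subseteq> convex hull S" "finite D" "convex hull S \<subseteq> (\<Union>y\<in>D. ball y (e / 2))"
        using compactE_image[OF finite_imp_compact_convex_hull[OF S], of "convex hull S" "\<lambda>y. ball y (e / 2)"]
        by auto
      have "A0 \<inter> (\<Inter>y\<in>D. Av y) \<in> G" by (rule finite_Inter_in_family[OF GI A0 D(2) Av(1)])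
      moreover have "e / 2 \<le> norm (u - v)" if u: "u \<in> convex hull S" and v: "v \<in> A0 \<inter> (\<Inter>y\<in>D. Av y)" for u v
      proof -
        obtain y where y: "y \<in> D" "dist y u < e / 2" using D(3) u by auto
        then have "v \<in> Av y" using v by blast
        then have "v \<notin> cball y e" using Av(2)[of y] by blast
        then show ?thesis using y dist_triangle[of y v u] by (simp add: dist_norm)
      qed
      ultimately show ?thesis by blast
    qed
    then obtain g where g: "\<And>S. finite S \<Longrightarrow> g S \<in> G"
      "\<And>S u v. finite S \<Longrightarrow> u \<in> convex hull S \<Longrightarrow> v \<in> g S \<Longrightarrow> e / 2 \<le> norm (u - v)" by metis
    have "\<exists>x :: nat \<Rightarrow> 'a. \<forall>n. \<forall>k\<le>n. x n \<in> g (x ` {..<k})"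
    proof (rule dependent_wellorder_choice)
      fix r and f h :: "nat \<Rightarrow> 'a" and n :: nat assume "\<And>k. k < n \<Longrightarrow> f k = h k"
      then have "f ` {..<k} = h ` {..<k}" if "k \<le> n" for k using that by (intro image_cong) auto
      then show "(\<forall>k\<le>n. r \<in> g (f ` {..<k})) = (\<forall>k\<le>n. r \<in> g (h ` {..<k}))" by auto
    next
      fix f :: "nat \<Rightarrow> 'a" and n :: nat
      have "A0 \<inter> (\<Inter>k\<in>{..n}. g (f ` {..<k})) \<in> G"
        by (rule finite_Inter_in_family[OF GI A0]) (use g in auto)
      then show "\<exists>r. \<forall>k\<le>n. r \<in> g (f ` {..<k})" using GK(4) by blast
    qed
    then obtain x :: "nat \<Rightarrow> 'a" where x: "\<And>n k. k \<le> n \<Longrightarrow> x n \<in> g (x ` {..<k})" by blast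
    have "x k \<in> g {}" for k using x[of 0 k] by simp
    then obtain M where M: "\<And>k. norm (x k) \<le> M"
      using GK(3)[OF g(1)[of "{}"]] unfolding bounded_iff by blast
    have sep: "e / 2 \<le> norm (u - v)" if u: "u \<in> convex hull (x ` {..<p})" and v: "v \<in> convex hull (x ` {p..})" for p u v
    proof (rule g(2)[OF _ u])
      have "convex hull (x ` {p..}) \<subseteq> g (x ` {..<p})"
        by (rule hull_minimal) (use x GK(2) g(1) in auto)
      then show "v \<in> g (x ` {..<p})" using v by blast
    qed simp
    have "e / 2 \<le> 0" using ns M sep by (rule nonsquare_not_separated)
    then show ?thesis using e by simp
  qed
  then show "\<Inter>F \<noteq> {}" using FG by blast
qed

text \<open>
  For an ultrafilter \<open>U\<close> this is convergence in the weak topology: closed half-spaces are closed convex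
  sets, and closed convex sets are weakly closed.
\<close>

definition convex_limit :: "'b filter \<Rightarrow> ('b \<Rightarrow> 'a::real_normed_vector) \<Rightarrow> 'a \<Rightarrow> bool" where
  "convex_limit U x z \<longleftrightarrow> (\<forall>S. closed S \<longrightarrow> convex S \<longrightarrow> eventually (\<lambda>n. x n \<in> S) U \<longrightarrow> z \<in> S)"

lemma convex_limitD:
  "convex_limit U x z \<Longrightarrow> closed S \<Longrightarrow> convex S \<Longrightarrow> eventually (\<lambda>n. x n \<in> S) U \<Longrightarrow> z \<in> S"
  unfolding convex_limit_def by blast

lemma convex_limit_snd:
  assumes "convex_limit U (\<lambda>n. (x n, w n)) (y, z)" shows "convex_limit U w z"
  unfolding convex_limit_def
proof (intro allI impI)
  fix S assume "closed S" "convex S" "eventually (\<lambda>n. w n \<in> S) U"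
  then have "(y, z) \<in> UNIV \<times> S"
    by (intro convex_limitD[OF assms]) (auto simp: closed_Times convex_Times)
  then show "z \<in> S" by simp
qed

text \<open>
  Convex limits of pairs make convex limits compatible with subtraction: \<open>z - y\<close> is controlled by
  \<open>w - x\<close> once \<open>(y, z)\<close> is a limit of the pairs, since the difference map is linear. The limit \<open>y\<close> of the
  first components is prescribed, so the second component has to be found in the sections of the
  convex sets over small balls around \<open>y\<close>.
\<close>

lemma convex_limit_pair:
  fixes x w :: "'b \<Rightarrow> 'a::real_normed_vector"
  assumes cc: "convexly_compact TYPE('a)" and U: "U \<noteq> bot"
    and y: "convex_limit U x y" and w: "\<And>n. norm (w n) \<le> M"
  shows "\<exists>z. convex_limit U (\<lambda>n. (x n, w n)) (y, z)"
proof -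
  define E where "E = {A. closed A \<and> convex A \<and> A \<subseteq> UNIV \<times> cball 0 M \<and> eventually (\<lambda>n. (x n, w n) \<in> A) U}"
  define P where "P A e = closure (snd ` (A \<inter> cball y e \<times> UNIV))" for A :: "('a \<times> 'a) set" and e :: real
  let ?F = "{P A e | A e. A \<in> E \<and> 0 < e}"
  have E0: "UNIV \<times> cball 0 M \<in> E" using w by (auto simp: E_def closed_Times convex_Times)
  have near: "\<exists>a b. (a, b) \<in> A \<and> dist y a < e" if A: "A \<in> E" and e: "0 < e" for A e
  proof -
    have "y \<in> closure (fst ` A)"
    proof (rule convex_limitD[OF y])
      show "convex (closure (fst ` A))"
        using A by (intro convex_closure convex_linear_image linear_fst) (auto simp: E_def)
      have "eventually (\<lambda>n. (x n, w n) \<in> A) U" using A by (simp add: E_def)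
      then show "eventually (\<lambda>n. x n \<in> closure (fst ` A)) U"
        by eventually_elim (use closure_subset in force)
    qed simp
    then obtain p where "p \<in> A" "dist (fst p) y < e" using e unfolding closure_approachable by auto
    then show ?thesis by (intro exI[of _ "fst p"] exI[of _ "snd p"]) (simp add: dist_commute)
  qed
  have "\<Inter>?F \<noteq> {}"
  proof (rule cc[unfolded convexly_compact_def, rule_format], intro conjI ballI)
    show "?F \<noteq> {}" using E0 zero_less_one by blast
    fix B assume "B \<in> ?F"
    then obtain A e where A: "A \<in> E" and e: "0 < e" and B: "B = P A e" by blast
    show "closed B" by (simp add: B P_def)
    show "convex B" unfolding B P_def using A
      by (intro convex_closure convex_linear_image linear_snd convex_Int convex_Times) (auto simp: E_def)
    have "B \<subseteq> cball 0 M" unfolding B P_def by (rule closure_minimal) (use A in \<open>auto simp: E_def\<close>)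
    then show "bounded B" using bounded_cball bounded_subset by blast
    obtain a b where "(a, b) \<in> A" "dist y a < e" using near[OF A e] by blast
    then have "b \<in> snd ` (A \<inter> cball y e \<times> UNIV)" by (force simp: image_iff)
    then show "B \<noteq> {}" unfolding B P_def using closure_subset by blast
    fix B' assume "B' \<in> ?F"
    then obtain A' e' where A': "A' \<in> E" and e': "0 < e'" and B': "B' = P A' e'" by blast
    have "A \<inter> A' \<in> E" using A A' by (auto simp: E_def convex_Int eventually_conj closed_Int)
    then have "P (A \<inter> A') (min e e') \<in> ?F"
      using e e' by (intro CollectI exI[of _ "A \<inter> A'"] exI[of _ "min e e'"]) simp
    moreover have "P (A \<inter> A') (min e e') \<subseteq> B" "P (A \<inter> A') (min e e') \<subseteq> B'"
      unfolding B B' P_def by (intro closure_mono image_mono; auto)+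
    ultimately show "\<exists>C\<in>?F. C \<subseteq> B \<inter> B'" by blast
  qed
  then obtain z where z: "\<And>A e. A \<in> E \<Longrightarrow> 0 < e \<Longrightarrow> z \<in> P A e" by blast
  have inE: "(y, z) \<in> A" if A: "A \<in> E" for A
  proof -
    have "\<exists>p\<in>A. dist p (y, z) < e" if e: "0 < e" for e
    proof -
      have "z \<in> P A (e / 2)" using z[OF A] e by simp
      then obtain a b where ab: "(a, b) \<in> A" "dist y a \<le> e / 2" "dist b z < e / 2"
        using e unfolding P_def closure_approachable by (auto dest!: spec[of _ "e / 2"])
      have "dist (a, b) (y, z) \<le> dist a y + dist b z"
        unfolding dist_Pair_Pair by (rule sqrt_sum_squares_le_sum) auto
      then have "dist (a, b) (y, z) < e" using ab by (simp add: dist_commute)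
      then show ?thesis using ab by blast
    qed
    then have "(y, z) \<in> closure A" unfolding closure_approachable by blast
    then show ?thesis using A by (simp add: E_def)
  qed
  have "(y, z) \<in> A" if A: "closed A" "convex A" "eventually (\<lambda>n. (x n, w n) \<in> A) U" for A
  proof -
    have "A \<inter> UNIV \<times> cball 0 M \<in> E"
      using A w by (auto simp: E_def closed_Times convex_Times closed_Int convex_Int)
    then show ?thesis using inE by blast
  qed
  then show ?thesis unfolding convex_limit_def by blast
qed

lemma convex_limit_exists:
  fixes w :: "'b \<Rightarrow> 'a::real_normed_vector"
  assumes "convexly_compact TYPE('a)" "U \<noteq> bot" "\<And>n. norm (w n) \<le> M"
  shows "\<exists>z. convex_limit U w z"
proof -
  have "convex_limit U (\<lambda>n. 0 :: 'a) 0"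
    using eventually_happens'[OF assms(2)] by (auto simp: convex_limit_def)
  from convex_limit_pair[where w = w, OF assms(1,2) this assms(3)]
  obtain z where "convex_limit U (\<lambda>n. (0 :: 'a, w n)) (0, z)" by (rule exE)
  then have "convex_limit U w z" by (rule convex_limit_snd)
  then show ?thesis by (rule exI)
qed

section \<open>Minimal invariant sets of nonexpansive maps\<close>

definition minimal_invariant :: "('a::real_normed_vector \<Rightarrow> 'a) \<Rightarrow> 'a set \<Rightarrow> bool" where
  "minimal_invariant T D \<longleftrightarrow> closed D \<and> convex D \<and> bounded D \<and> D \<noteq> {} \<and> T ` D \<subseteq> D \<and>
     (\<forall>E. closed E \<longrightarrow> convex E \<longrightarrow> E \<noteq> {} \<longrightarrow> E \<subseteq> D \<longrightarrow> T ` E \<subseteq> E \<longrightarrow> E = D)"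

lemma minimal_invariant_exists:
  fixes C :: "'a::real_normed_vector set"
  assumes cc: "convexly_compact TYPE('a)"
    and C: "closed C" "convex C" "bounded C" "C \<noteq> {}" "T ` C \<subseteq> C"
  shows "\<exists>D\<subseteq>C. minimal_invariant T D"
proof -
  define K where "K = {A :: 'a set. closed A \<and> convex A \<and> bounded A \<and> A \<noteq> {} \<and> T ` A \<subseteq> A}"
  have "{C} \<subseteq> K" using C by (simp add: K_def)
  moreover have "A \<inter> B \<in> {C}" if "A \<in> {C}" "B \<in> {C}" for A B using that by simp
  ultimately have "\<exists>G. {C} \<subseteq> G \<and> G \<subseteq> K \<and> (\<forall>A\<in>G. \<forall>B\<in>G. A \<inter> B \<in> G) \<and>
      (\<forall>D. (\<forall>B\<in>G. B \<inter> D \<in> K) \<longrightarrow> (\<forall>A\<in>G. A \<inter> D \<in> G))"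
    by (rule maximal_intersection_closed_family)
  then obtain G where max: "{C} \<subseteq> G \<and> G \<subseteq> K \<and> (\<forall>A\<in>G. \<forall>B\<in>G. A \<inter> B \<in> G) \<and>
      (\<forall>D. (\<forall>B\<in>G. B \<inter> D \<in> K) \<longrightarrow> (\<forall>A\<in>G. A \<inter> D \<in> G))" by (rule exE)
  have CG: "C \<in> G" using max by simp
  from max have "G \<subseteq> K" by (rule conjunct1[OF conjunct2])
  then have GK: "closed A" "convex A" "bounded A" "A \<noteq> {}" "T ` A \<subseteq> A" if "A \<in> G" for A
    using that by (auto simp: K_def)
  have GI: "A \<inter> B \<in> G" if "A \<in> G" "B \<in> G" for A B using max that by simp
  have mx: "A \<inter> D \<in> G" if "\<forall>B\<in>G. B \<inter> D \<in> K" "A \<in> G" for A D using max that by simp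
  have ne: "\<Inter>G \<noteq> {}"
  proof (rule cc[unfolded convexly_compact_def, rule_format], intro conjI ballI)
    show "G \<noteq> {}" using CG by auto
    show "\<exists>B\<in>G. B \<subseteq> A \<inter> A'" if "A \<in> G" "A' \<in> G" for A A'
      using GI[OF that] by (rule bexI[rotated]) simp
  qed (use GK in blast)+
  have sub: "\<Inter>G \<subseteq> C" using CG by (rule Inter_lower)
  have "E = \<Inter>G" if E: "closed E" "convex E" "E \<noteq> {}" "E \<subseteq> \<Inter>G" "T ` E \<subseteq> E" for E
  proof -
    have inter: "B \<inter> E = E" if "B \<in> G" for B using E(4) that by auto
    have "bounded E" using bounded_subset[OF C(3)] E(4) sub by auto
    then have "E \<in> K" using E by (simp add: K_def)
    then have "C \<inter> E \<in> G" by (intro mx CG) (simp add: inter)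
    then have "E \<in> G" by (simp add: inter CG)
    then show ?thesis using E(4) by (intro equalityI Inter_lower)
  qed
  moreover have "closed (\<Inter>G)" "convex (\<Inter>G)" "bounded (\<Inter>G)"
    using GK bounded_subset[OF C(3) sub] by (simp_all add: closed_Inter convex_Inter)
  moreover have "T ` \<Inter>G \<subseteq> \<Inter>G" using GK(5) by fast
  ultimately have "minimal_invariant T (\<Inter>G)" using ne by (simp add: minimal_invariant_def)
  then show ?thesis using sub by (intro exI[of _ "\<Inter>G"]) simp
qed

locale minimal_nonexpansive = free_ultrafilter +
  fixes T :: "'a::banach \<Rightarrow> 'a" and D :: "'a set"
  assumes cc: "convexly_compact TYPE('a)"
    and minimal: "minimal_invariant T D"
    and nonexpansive: "\<lbrakk>x \<in> D; y \<in> D\<rbrakk> \<Longrightarrow> norm (T x - T y) \<le> norm (x - y)"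
begin

lemma D: "closed D" "convex D" "bounded D" "D \<noteq> {}" "\<And>x. x \<in> D \<Longrightarrow> T x \<in> D"
  using minimal by (auto simp: minimal_invariant_def)

lemma invariant_subset_eq:
  "\<lbrakk>closed E; convex E; E \<noteq> {}; E \<subseteq> D; \<And>x. x \<in> E \<Longrightarrow> T x \<in> E\<rbrakk> \<Longrightarrow> E = D"
  using minimal unfolding minimal_invariant_def by (simp add: image_subset_iff)

lemma combination_in_D: "\<lbrakk>x \<in> D; y \<in> D; 0 \<le> a; a \<le> 1\<rbrakk> \<Longrightarrow> (1 - a) *\<^sub>R x + a *\<^sub>R y \<in> D"
  using D(2) by (auto simp: convex_alt)

text \<open>
  The closed convex hull of the image is itself invariant, hence by minimality everything.
\<close>

lemma image_spans: "closure (convex hull (T ` D)) = D"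
proof (rule invariant_subset_eq)
  have "convex hull (T ` D) \<subseteq> D" using D by (intro hull_minimal) auto
  then show sub: "closure (convex hull (T ` D)) \<subseteq> D" using D(1) by (rule closure_minimal)
  show "T x \<in> closure (convex hull (T ` D))" if "x \<in> closure (convex hull (T ` D))" for x
    using that sub closure_subset hull_subset[of "T ` D" convex] by blast
  show "closure (convex hull (T ` D)) \<noteq> {}" using D(4) by simp
qed (simp_all add: convex_closure)

text \<open>
  The points from which all of \<open>D\<close> lies within distance \<open>t\<close> form an invariant closed convex set: if
  \<open>u\<close> is such a point, the ball of radius \<open>t\<close> around \<open>T u\<close> contains \<open>T ` D\<close>, which spans \<open>D\<close>. So if
  there is one such point, all points of \<open>D\<close> are of this kind.
\<close>

lemma diametral:
  assumes x: "x \<in> D" and t: "\<And>y. y \<in> D \<Longrightarrow> norm (x - y) \<le> t" and y: "y \<in> D" "z \<in> D"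
  shows "norm (y - z) \<le> t"
proof -
  let ?E = "D \<inter> (\<Inter>y\<in>D. cball y t)"
  have "?E = D"
  proof (rule invariant_subset_eq)
    show "closed ?E" "convex ?E" using D by (auto intro: convex_INT convex_Int)
    show "?E \<noteq> {}" using x t by (auto simp: dist_norm norm_minus_commute)
    show "T u \<in> ?E" if u: "u \<in> ?E" for u
    proof -
      have "T ` D \<subseteq> cball (T u) t"
      proof (intro image_subsetI)
        fix v assume v: "v \<in> D"
        then have "dist v u \<le> t" using u by auto
        then show "T v \<in> cball (T u) t" using nonexpansive[of u v] u v
          by (auto simp: dist_norm norm_minus_commute)
      qed
      then have "closure (convex hull (T ` D)) \<subseteq> cball (T u) t"
        by (intro closure_minimal hull_minimal) auto
      then have "D \<subseteq> cball (T u) t" by (simp only: image_spans)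
      moreover have "T u \<in> D" using u D by blast
      ultimately show ?thesis by (auto simp: dist_commute)
    qed
  qed simp
  then have "y \<in> cball z t" using y by blast
  then show ?thesis by (simp add: dist_norm norm_minus_commute)
qed

lemma bounded_norm: obtains M where "\<And>y. y \<in> D \<Longrightarrow> norm y \<le> M"
  using D(3) unfolding bounded_iff by blast

lemma limit_in_D:
  assumes "convex_limit U x z" "\<And>n. x n \<in> D"
  shows "z \<in> D"
  using D(1,2) assms by (intro convex_limitD[OF assms(1)] always_eventually allI)

text \<open>
  The Goebel--Karlovitz lemma. The points of \<open>D\<close> from which almost all \<open>y n\<close> have distance at most
  about \<open>s\<close> form an invariant closed convex set, because \<open>T\<close> almost fixes \<open>y n\<close>. So this holds for
  all points of \<open>D\<close> if it holds for one, and then every point of \<open>D\<close> lies within \<open>s\<close> of the convex limit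
  of \<open>y\<close>, which bounds the diameter.
\<close>

lemma approximate_fixed_points_far:
  assumes y: "\<And>n. y n \<in> D" "(\<lambda>n. norm (T (y n) - y n)) \<longlonglongrightarrow> 0"
    and x: "x \<in> D" "\<And>n. norm (y n - x) \<le> s" and uv: "u \<in> D" "v \<in> D"
  shows "norm (u - v) \<le> s"
proof -
  let ?E = "{x\<in>D. \<forall>e>0. eventually (\<lambda>n. norm (y n - x) \<le> s + e) U}"
  have E: "?E = D"
  proof (rule invariant_subset_eq)
    have "eventually (\<lambda>n. norm (y n - x) \<le> s + e) U" if "e > 0" for e
      using that by (intro always_eventually allI order_trans[OF x(2)]) simp
    then have "x \<in> ?E" using x(1) by simp
    then show "?E \<noteq> {}" by (rule ex_in_conv[THEN iffD1, OF exI])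
    show "convex ?E"
    proof (rule convexI)
      fix p q and a b :: real assume p: "p \<in> ?E" and q: "q \<in> ?E" and ab: "0 \<le> a" "0 \<le> b" "a + b = 1"
      have "eventually (\<lambda>n. norm (y n - (a *\<^sub>R p + b *\<^sub>R q)) \<le> s + e) U" if e: "e > 0" for e
      proof -
        have "eventually (\<lambda>n. norm (y n - p) \<le> s + e) U" "eventually (\<lambda>n. norm (y n - q) \<le> s + e) U"
          using p q e by auto
        then show ?thesis
        proof eventually_elim
          case (elim n)
          then have "p \<in> cball (y n) (s + e)" "q \<in> cball (y n) (s + e)" by (auto simp: dist_norm)
          then have "a *\<^sub>R p + b *\<^sub>R q \<in> cball (y n) (s + e)" using ab by (rule convexD[OF convex_cball])
          then show ?case by (simp add: dist_norm)
        qed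
      qed
      then show "a *\<^sub>R p + b *\<^sub>R q \<in> ?E" using p q ab convexD[OF D(2)] by auto
    qed
    show "closed ?E" unfolding closed_sequential_limits
    proof (intro allI impI)
      fix p l assume p: "(\<forall>n. p n \<in> ?E) \<and> p \<longlonglongrightarrow> l"
      have "l \<in> D" using closed_sequentially[OF D(1)] p by blast
      moreover have "eventually (\<lambda>n. norm (y n - l) \<le> s + e) U" if e: "e > 0" for e
      proof -
        obtain k where k: "dist (p k) l < e / 2"
          using p e by (meson half_gt_zero lim_sequentially order_refl)
        have "eventually (\<lambda>n. norm (y n - p k) \<le> s + e / 2) U" using p e by auto
        then show ?thesis
        proof eventually_elim
          case (elim n)
          then show ?case using k norm_triangle_ineq[of "y n - p k" "p k - l"] by (simp add: dist_norm)
        qed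
      qed
      ultimately show "l \<in> ?E" by simp
    qed
    show "T p \<in> ?E" if p: "p \<in> ?E" for p
    proof -
      have "eventually (\<lambda>n. norm (y n - T p) \<le> s + e) U" if e: "e > 0" for e
      proof -
        have "eventually (\<lambda>n. norm (T (y n) - y n) < e / 2) U"
          using sequential_limit[OF y(2)] e by (intro order_tendstoD) auto
        moreover have "eventually (\<lambda>n. norm (y n - p) \<le> s + e / 2) U" using p e by auto
        ultimately show ?thesis
        proof eventually_elim
          case (elim n)
          have "norm (T (y n) - T p) \<le> norm (y n - p)" using p y by (intro nonexpansive) auto
          then show ?case using elim norm_triangle_ineq4[of "T (y n) - T p" "T (y n) - y n"] by simp
        qed
      qed
      then show ?thesis using p D(5) by blast
    qed
  qed blast
  obtain M where M: "\<And>y. y \<in> D \<Longrightarrow> norm y \<le> M" using bounded_norm by blast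
  obtain z where z: "convex_limit U y z"
    using convex_limit_exists[OF cc proper, of y M] M y by blast
  have zx: "norm (z - x) \<le> s + e" if "x \<in> D" "e > 0" for x e
  proof -
    have "x \<in> ?E" using E that by blast
    then have "eventually (\<lambda>n. y n \<in> cball x (s + e)) U"
      using that by (auto simp: dist_norm norm_minus_commute)
    then have "z \<in> cball x (s + e)" by (intro convex_limitD[OF z]) auto
    then show ?thesis by (simp add: dist_norm norm_minus_commute)
  qed
  have "norm (u - v) \<le> s + e" if "e > 0" for e
    by (rule diametral[OF limit_in_D[OF z y(1)] _ uv]) (use zx that in blast)
  then show ?thesis by (rule field_le_epsilon)
qed

lemma approximate_fixed_points_uniformly_far:
  assumes x: "x \<in> D" and uv: "u \<in> D" "v \<in> D" and s: "s < norm (u - v)"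
  shows "\<exists>\<delta>>0. \<forall>y\<in>D. norm (T y - y) \<le> \<delta> \<longrightarrow> s < norm (y - x)"
proof (rule ccontr)
  assume c: "\<not> ?thesis"
  have "\<exists>y\<in>D. norm (T y - y) \<le> 1 / real (Suc n) \<and> norm (y - x) \<le> s" for n
    using c by (auto simp: not_less dest!: spec[of _ "1 / real (Suc n)"])
  then obtain y where y: "\<And>n. y n \<in> D" "\<And>n. norm (T (y n) - y n) \<le> 1 / real (Suc n)"
    "\<And>n. norm (y n - x) \<le> s" by metis
  have "(\<lambda>n. norm (T (y n) - y n)) \<longlonglongrightarrow> 0"
    using y(2) by (rule norm_tendsto_0_if_le_harmonic)
  then have "norm (u - v) \<le> s" by (rule approximate_fixed_points_far[OF y(1) _ x y(3) uv])
  then show False using s by simp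
qed

text \<open>
  Contracting the map towards a point of \<open>D\<close> makes it a strict contraction, to which Banach's theorem
  applies.
\<close>

lemma averaged_fixed_point:
  assumes a: "0 < a" "a \<le> 1" and c: "c \<in> D"
  shows "\<exists>w\<in>D. (1 - a) *\<^sub>R T w + a *\<^sub>R c = w"
proof -
  have "\<exists>!w. w \<in> D \<and> (1 - a) *\<^sub>R T w + a *\<^sub>R c = w"
  proof (rule Banach_fix[where c = "1 - a"])
    show "complete D" using D(1) by (simp add: complete_eq_closed)
    show "dist ((1 - a) *\<^sub>R T x + a *\<^sub>R c) ((1 - a) *\<^sub>R T y + a *\<^sub>R c) \<le> (1 - a) * dist x y"
      if "x \<in> D" "y \<in> D" for x y
      using nonexpansive[of x y] that a
      by (simp add: dist_norm mult_left_mono flip: scaleR_diff_right)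
    show "(\<lambda>w. (1 - a) *\<^sub>R T w + a *\<^sub>R c) ` D \<subseteq> D"
      using combination_in_D[OF D(5) c] a by auto
  qed (use a D in auto)
  then show ?thesis by blast
qed

lemma approximate_fixed_point_sequence:
  "\<exists>x. (\<forall>n. x n \<in> D) \<and> (\<lambda>n. norm (T (x n) - x n)) \<longlonglongrightarrow> 0"
proof -
  obtain c where c: "c \<in> D" using D by blast
  obtain M where M: "\<And>y. y \<in> D \<Longrightarrow> norm y \<le> M" using bounded_norm by blast
  have "\<exists>w\<in>D. (1 - 1 / real (Suc n)) *\<^sub>R T w + (1 / real (Suc n)) *\<^sub>R c = w" for n
    by (rule averaged_fixed_point) (use c in auto)
  then obtain w where w: "\<And>n. w n \<in> D"
    "\<And>n. (1 - 1 / real (Suc n)) *\<^sub>R T (w n) + (1 / real (Suc n)) *\<^sub>R c = w n" by metis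
  have b: "norm (T (w n) - w n) \<le> 2 * M / real (Suc n)" for n
  proof -
    have "T (w n) - w n = (1 / real (Suc n)) *\<^sub>R (T (w n) - c)"
      using w(2)[of n] by (simp add: algebra_simps)
    then have "norm (T (w n) - w n) = 1 / real (Suc n) * norm (T (w n) - c)" by simp
    also have "1 / real (Suc n) * norm (T (w n) - c) = norm (T (w n) - c) / real (Suc n)" by simp
    also have "norm (T (w n) - c) \<le> 2 * M"
      using norm_triangle_ineq4[of "T (w n)" c] M[OF c] M[OF D(5)[OF w(1)[of n]]] by linarith
    finally show ?thesis by (simp add: divide_right_mono)
  qed
  then have "(\<lambda>n. norm (T (w n) - w n)) \<longlonglongrightarrow> 0" by (rule norm_tendsto_0_if_le_harmonic)
  then show ?thesis using w(1) by (intro exI[of _ w]) simp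
qed

text \<open>
  The geometric heart of the second step: vectors \<open>p\<close> and \<open>q\<close> of norm about \<open>d / 2\<close> with both \<open>p + q\<close>
  and \<open>p - q\<close> of norm about \<open>d\<close>, found as \<open>p = z - z0\<close> and \<open>q = w m - w n\<close>. Passing to the limit
  \<open>z\<close> in \<open>w m\<close> turns \<open>p - q\<close> into \<open>w n - z0\<close>, and passing to the limit in \<open>w n\<close> turns \<open>p + q\<close> into
  \<open>w m - z0\<close>; both have norm above \<open>s\<close>, and balls are convex, so convex limits suffice.
\<close>

lemma almost_square:
  assumes d: "\<And>y z. y \<in> D \<Longrightarrow> z \<in> D \<Longrightarrow> norm (y - z) \<le> d" and uv: "u \<in> D" "v \<in> D" "s < norm (u - v)"
    and e: "0 < e"
  shows "\<exists>p q :: 'a. norm p \<le> d / 2 + e \<and> norm q \<le> d / 2 + e \<and> s < norm (p + q) \<and> s < norm (p - q)"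
proof -
  obtain s' where s': "s < s'" "s' < norm (u - v)" using uv dense by blast
  obtain M where M: "\<And>y. y \<in> D \<Longrightarrow> norm y \<le> M" using bounded_norm by blast
  have d0: "0 \<le> d" using d[OF uv(1,2)] norm_ge_zero order_trans by blast
  obtain x where x: "\<And>n. x n \<in> D" "(\<lambda>n. norm (T (x n) - x n)) \<longlonglongrightarrow> 0"
    using approximate_fixed_point_sequence by blast
  obtain z0 where z0: "convex_limit U x z0"
    using convex_limit_exists[OF cc proper, of x M] M x by blast
  have z0D: "z0 \<in> D" using limit_in_D[OF z0 x(1)] .
  obtain \<delta> where \<delta>: "0 < \<delta>" "\<And>y. y \<in> D \<Longrightarrow> norm (T y - y) \<le> \<delta> \<Longrightarrow> s' < norm (y - z0)"
    using approximate_fixed_points_uniformly_far[OF z0D uv(1,2) s'(2)] by blast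
  \<comment> \<open>With weight \<open>a\<close>, the fixed points of the perturbed maps are moved by \<open>T\<close> by at most \<open>a * d \<le> \<delta>\<close>.\<close>
  define a where "a = min 1 (\<delta> / (d + 1))"
  have a: "0 < a" "a \<le> 1" using \<delta> d0 by (simp_all add: a_def)
  have "a * d \<le> \<delta> / (d + 1) * d" using d0 by (intro mult_right_mono) (simp_all add: a_def)
  also have "\<dots> \<le> \<delta>" using d0 \<delta> by (simp add: field_simps)
  finally have ad: "a * d \<le> \<delta>" .
  \<comment> \<open>The midpoint of \<open>x n\<close> and \<open>z0\<close>, in the form of \<open>combination_in_D\<close>.\<close>
  define c where "c n = (1 - 1 / 2 :: real) *\<^sub>R x n + (1 / 2 :: real) *\<^sub>R z0" for n
  have cD: "c n \<in> D" for n unfolding c_def by (rule combination_in_D) (use x z0D in auto)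
  have "\<exists>w\<in>D. (1 - a) *\<^sub>R T w + a *\<^sub>R c n = w" for n using averaged_fixed_point[OF a cD] .
  then obtain w where wD: "\<And>n. w n \<in> D" and w: "\<And>n. (1 - a) *\<^sub>R T (w n) + a *\<^sub>R c n = w n" by metis
  have q: "norm (w n - w m) \<le> d / 2" for n m
  proof -
    have "w n - w m = (1 - a) *\<^sub>R (T (w n) - T (w m)) + a *\<^sub>R (c n - c m)"
      by (subst (1 2) w[symmetric]) (simp add: algebra_simps)
    then have "norm (w n - w m) \<le> (1 - a) * norm (T (w n) - T (w m)) + a * norm (c n - c m)"
      using norm_triangle_ineq[of "(1 - a) *\<^sub>R (T (w n) - T (w m))" "a *\<^sub>R (c n - c m)"] a by simp
    also have "\<dots> \<le> (1 - a) * norm (w n - w m) + a * (d / 2)"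
    proof (intro add_mono mult_left_mono)
      show "norm (T (w n) - T (w m)) \<le> norm (w n - w m)" by (intro nonexpansive wD)
      have "c n - c m = (1 / 2 :: real) *\<^sub>R (x n - x m)" by (simp add: c_def algebra_simps)
      then show "norm (c n - c m) \<le> d / 2" using d[OF x(1) x(1), of n m] by simp
    qed (use a in auto)
    finally have "a * norm (w n - w m) \<le> a * (d / 2)" by (simp add: algebra_simps)
    then show ?thesis using a by (simp only: mult_le_cancel_left_pos)
  qed
  have wx: "norm (w n - x n) \<le> norm (T (x n) - x n) / a + d / 2" for n
  proof -
    have "w n - x n = (1 - a) *\<^sub>R (T (w n) - T (x n)) + (1 - a) *\<^sub>R (T (x n) - x n) + a *\<^sub>R (c n - x n)"
      by (subst (1) w[symmetric]) (simp add: algebra_simps)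
    then have "norm (w n - x n) \<le> (1 - a) * norm (T (w n) - T (x n)) + (1 - a) * norm (T (x n) - x n)
        + a * norm (c n - x n)"
      using norm_triangle_ineq[of "(1 - a) *\<^sub>R (T (w n) - T (x n)) + (1 - a) *\<^sub>R (T (x n) - x n)" "a *\<^sub>R (c n - x n)"]
        norm_triangle_ineq[of "(1 - a) *\<^sub>R (T (w n) - T (x n))" "(1 - a) *\<^sub>R (T (x n) - x n)"] a by simp
    also have "\<dots> \<le> (1 - a) * norm (w n - x n) + 1 * norm (T (x n) - x n) + a * (d / 2)"
    proof (intro add_mono mult_left_mono mult_right_mono)
      show "norm (T (w n) - T (x n)) \<le> norm (w n - x n)" by (intro nonexpansive wD x)
      have "c n - x n = (1 / 2 :: real) *\<^sub>R (z0 - x n)" 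
        by (simp add: c_def algebra_simps) (simp flip: scaleR_add_left)
      then show "norm (c n - x n) \<le> d / 2" using d[OF z0D x(1), of n] by simp
    qed (use a in auto)
    finally have "a * norm (w n - x n) \<le> norm (T (x n) - x n) + a * (d / 2)" by (simp add: algebra_simps)
    then show ?thesis using a by (simp add: field_simps)
  qed
  have far: "s' < norm (w n - z0)" for n
  proof (rule \<delta>(2)[OF wD])
    have "T (w n) - w n = a *\<^sub>R (T (w n) - c n)" using w[of n] by (simp add: algebra_simps)
    then have "norm (T (w n) - w n) = a * norm (T (w n) - c n)" using a by simp
    also have "\<dots> \<le> a * d" using d[OF D(5)[OF wD] cD] a by (intro mult_left_mono) auto
    finally show "norm (T (w n) - w n) \<le> \<delta>" using ad by simp
  qed
  obtain z where xz: "convex_limit U (\<lambda>n. (x n, w n)) (z0, z)"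
    using convex_limit_pair[OF cc proper z0, of w M] M wD by blast
  then have z: "convex_limit U w z" by (rule convex_limit_snd)
  define p where "p = z - z0"
  have p: "norm p \<le> d / 2 + e"
  proof -
    have lin: "linear (\<lambda>y :: 'a \<times> 'a. snd y - fst y)"
      by (intro linear_compose_sub linear_fst linear_snd)
    have "(z0, z) \<in> (\<lambda>y. snd y - fst y) -` cball 0 (d / 2 + e)"
    proof (rule convex_limitD[OF xz])
      show "closed ((\<lambda>y :: 'a \<times> 'a. snd y - fst y) -` cball 0 (d / 2 + e))"
        by (intro closed_vimage continuous_intros) simp
      show "convex ((\<lambda>y :: 'a \<times> 'a. snd y - fst y) -` cball 0 (d / 2 + e))"
        using lin by (rule convex_linear_vimage) simp
      have "eventually (\<lambda>n. norm (T (x n) - x n) < a * e) U"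
        using sequential_limit[OF x(2)] a e by (intro order_tendstoD) auto
      then show "eventually (\<lambda>n. (x n, w n) \<in> (\<lambda>y. snd y - fst y) -` cball 0 (d / 2 + e)) U"
      proof eventually_elim
        case (elim n)
        then have "norm (T (x n) - x n) / a < e" using a by (simp add: field_simps)
        then show ?case using wx[of n] by simp
      qed
    qed
    then show ?thesis by (simp add: p_def)
  qed
  have minus: "eventually (\<lambda>m. s < norm (p - (w m - w n))) U" for n
  proof (rule ccontr)
    assume "\<not> ?thesis"
    then have "eventually (\<lambda>m. w m \<in> cball (w n + p) s) U"
      by (simp add: not_eventually_ultra not_less dist_norm algebra_simps)
    then have "z \<in> cball (w n + p) s" by (intro convex_limitD[OF z]) auto
    then show False using far[of n] s' by (simp add: dist_norm p_def)
  qed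
  have "eventually (\<lambda>n. eventually (\<lambda>m. s < norm (p + (w m - w n))) U) U"
  proof (rule ccontr)
    assume c: "\<not> ?thesis"
    \<comment> \<open>If the claim failed, almost all \<open>w n\<close>, hence also their limit \<open>z\<close>, would lie in this convex set.\<close>
    let ?S = "{y. \<forall>e>0. eventually (\<lambda>m. norm (p + (w m - y)) \<le> s + e) U}"
    have "z \<in> ?S"
    proof (rule convex_limitD[OF z])
      show "convex ?S"
      proof (rule convexI, clarify)
        fix f g e and a b :: real
        assume fg: "\<forall>e>0. eventually (\<lambda>m. norm (p + (w m - f)) \<le> s + e) U"
          "\<forall>e>0. eventually (\<lambda>m. norm (p + (w m - g)) \<le> s + e) U"
          and ab: "0 \<le> a" "0 \<le> b" "a + b = 1" and e: "0 < (e :: real)"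
        have "eventually (\<lambda>m. norm (p + (w m - f)) \<le> s + e) U"
          "eventually (\<lambda>m. norm (p + (w m - g)) \<le> s + e) U" using fg e by auto
        then show "eventually (\<lambda>m. norm (p + (w m - (a *\<^sub>R f + b *\<^sub>R g))) \<le> s + e) U"
        proof eventually_elim
          case (elim m)
          then have "f \<in> cball (p + w m) (s + e)" "g \<in> cball (p + w m) (s + e)"
            by (simp_all add: dist_norm add_diff_eq)
          then have "a *\<^sub>R f + b *\<^sub>R g \<in> cball (p + w m) (s + e)" using ab by (rule convexD[OF convex_cball])
          then show ?case by (simp add: dist_norm add_diff_eq)
        qed
      qed
      show "closed ?S" unfolding closed_sequential_limits
      proof (intro allI impI CollectI)
        fix f l and e :: real assume f: "(\<forall>n. f n \<in> ?S) \<and> f \<longlonglongrightarrow> l" and e: "0 < e"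
        obtain k where k: "dist (f k) l < e / 2"
          using f e by (meson half_gt_zero lim_sequentially order_refl)
        have "eventually (\<lambda>m. norm (p + (w m - f k)) \<le> s + e / 2) U" using f e by auto
        then show "eventually (\<lambda>m. norm (p + (w m - l)) \<le> s + e) U"
        proof eventually_elim
          case (elim m)
          then show ?case
            using k norm_triangle_ineq[of "p + (w m - f k)" "f k - l"]
            by (simp add: dist_norm add_diff_eq)
        qed
      qed
      from c have "eventually (\<lambda>n. eventually (\<lambda>m. norm (p + (w m - w n)) \<le> s) U) U"
        by (simp add: not_eventually_ultra not_less)
      then show "eventually (\<lambda>n. w n \<in> ?S) U"
      proof eventually_elim
        case (elim n)
        have "eventually (\<lambda>m. norm (p + (w m - w n)) \<le> s + e) U" if "e > 0" for e
          using elim by eventually_elim (use that in linarith)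
        then show ?case by blast
      qed
    qed
    then have "eventually (\<lambda>m. norm (p + (w m - z)) \<le> s + e) U" if "0 < e" for e using that by blast
    from eventually_happens'[OF proper this[of "s' - s"]] s'
    obtain m where "norm (p + (w m - z)) \<le> s'" by auto
    then show False using far[of m] by (simp add: p_def)
  qed
  then obtain n where "eventually (\<lambda>m. s < norm (p + (w m - w n))) U"
    using eventually_happens'[OF proper] by blast
  then obtain m where "s < norm (p + (w m - w n))" "s < norm (p - (w m - w n))"
    using eventually_happens'[OF proper eventually_conj[OF _ minus[of n]]] by blast
  moreover have "norm (w m - w n) \<le> d / 2 + e" using q[of m n] e by linarith
  ultimately show ?thesis using p by blast
qed

lemma singleton_if_nonsquare:
  assumes ns: "nonsquare TYPE('a) \<rho>" "\<rho> < 2" and uv: "u \<in> D" "v \<in> D"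
  shows "u = v"
proof (rule ccontr)
  assume "u \<noteq> v"
  define d where "d = diameter D"
  have d: "norm (y - z) \<le> d" if "y \<in> D" "z \<in> D" for y z
    using diameter_bounded_bound[OF D(3) that] by (simp add: d_def dist_norm)
  have "0 < norm (u - v)" using \<open>u \<noteq> v\<close> by simp
  then have "0 < d" using d[OF uv] by linarith
  \<comment> \<open>Any \<open>e\<close> with \<open>d - e > \<rho> * (d / 2 + e)\<close> contradicts nonsquareness; it suffices that \<open>3 e \<le> d (1 - \<rho> / 2)\<close>.\<close>
  define e where "e = d * (1 - \<rho> / 2) / 8"
  have e: "0 < e" using \<open>0 < d\<close> ns by (simp add: e_def)
  have "\<exists>y\<in>D. \<exists>z\<in>D. d - e < norm (y - z)"
  proof (rule ccontr)
    assume "\<not> ?thesis"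
    then have "diameter D \<le> d - e" using D(4) by (intro diameter_le) (auto simp: not_less)
    then show False using e by (simp add: d_def)
  qed
  then obtain y z where yz: "y \<in> D" "z \<in> D" "d - e < norm (y - z)" by blast
  have "\<exists>p q :: 'a. norm p \<le> d / 2 + e \<and> norm q \<le> d / 2 + e \<and> d - e < norm (p + q) \<and> d - e < norm (p - q)"
    by (rule almost_square[OF _ yz e]) (rule d)
  then obtain p q :: 'a where pq: "norm p \<le> d / 2 + e" "norm q \<le> d / 2 + e" "d - e < norm (p + q)" "d - e < norm (p - q)"
    by blast
  then have "d - e < \<rho> * (d / 2 + e)" using nonsquareD[OF ns(1) pq(1,2)] by auto
  also have "\<dots> \<le> \<rho> * (d / 2) + 2 * e" using ns e by (simp add: distrib_left)
  finally have "d * (1 - \<rho> / 2) < 3 * e" by (simp add: algebra_simps)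
  then show False using e by (simp add: e_def)
qed

end

theorem fixed_point_property_if_nonsquare:
  assumes ns: "nonsquare TYPE('a::banach) \<rho>" "\<rho> < 2"
  shows "fixed_point_property TYPE('a)"
  unfolding fixed_point_property_def
proof (intro allI impI, elim conjE)
  fix C :: "'a set" and T
  assume C: "C \<noteq> {}" "closed C" "bounded C" "convex C" "T \<in> C \<rightarrow> C" "nonexpansive_on C T"
  have cc: "convexly_compact TYPE('a)" using ns by (rule convexly_compact_if_nonsquare)
  obtain D where DC: "D \<subseteq> C" and min: "minimal_invariant T D"
    using minimal_invariant_exists[OF cc C(2,4,3,1), of T] C(5) by blast
  obtain U where "free_ultrafilter U" using free_ultrafilter_exists ..
  then interpret minimal_nonexpansive U T D
    using cc min DC C(6) by (auto intro!: minimal_nonexpansive.intro minimal_nonexpansive_axioms.intro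
        simp: nonexpansive_on_def)
  obtain u where u: "u \<in> D" using D(4) by blast
  have "T u = u" using D(5)[OF u] u by (rule singleton_if_nonsquare[OF ns])
  then show "\<exists>x\<in>C. T x = x" using u DC by (intro bexI[of _ u]) auto
qed

theorem theorem2p1:
  assumes "weak_star_seq_compact (cball 0 1 :: ('a::banach \<Rightarrow>\<^sub>L real) set)"
    and "\<not> fixed_point_property TYPE('a)"
  shows "james_constant TYPE('a) = 2"
proof (rule ccontr)
  assume "james_constant TYPE('a) \<noteq> 2"
  then obtain \<rho> where "nonsquare TYPE('a) \<rho>" "\<rho> < 2"
    using nonsquare_if_james_constant_ne_2 by blast
  then have "fixed_point_property TYPE('a)" by (rule fixed_point_property_if_nonsquare)
  with assms(2) show False ..
qed

end
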